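(* For every $\alpha^*\in[0.01,\infty)\cup\{\infty\}$ and $\beta^*\in[1,\infty)\cup\{\infty\}$ there exists a clustering instance $\mathcal V$ whose target clustering is the optimal $\ell_{\beta^*}$ clustering, such that $\mathtt{clus}_{\alpha^*,\beta^*}(\mathcal V)<\mathtt{clus}_{\alpha,\beta}(\mathcal V)$ for all $(\alpha,\beta)\in([0,\infty)\cup\{\infty\})\times([1,\infty)\cup\{\infty\})$ with $(\alpha,\beta)\neq(\alpha^*,\beta^* )$.
   Context: A clustering instance $\mathcal V=(V,d,k)$ consists of a finite point set $V$ (here allowed to lie in an abstract metric space), a metric $d$, and a number of clusters $k$; it comes with a target clustering $\{C_1^*,\dots,C_k^*\}$. For $\beta\in[1,\infty)$, the $\ell_\beta$ objective of a clustering $\{C_1,\dots,C_k\}$ with centers $c_i$ is $\bigl(\sum_i\sum_{v\in C_i}d(v,c_i)^\beta\bigr)^{1/\beta}$, and for $\beta=\infty$ it is $\max_i\max_{v\in C_i}d(v,c_i)$. The $(\alpha,\beta)$-Lloyds++ algorithm: Phase 1 ($d^\alpha$-sampling): starting from $C=\emptyset$, choose $k$ centers one at a time, each point $v$ being chosen with probability proportional to $d_{\min}(v,C)^\alpha$ where $d_{\min}(v,C)=\min_{c\in C}d(v,c)$ (first center uniform; for $\alpha=\infty$, farthest-first traversal: next center uniform among the points maximizing $d_{\min}(\cdot,C)$). Phase 2 ($\beta$-Lloyd's method): repeat: take the Voronoi partition $\{C_1,\dots,C_k\}$ of $V$ induced by $C$; replace the center of each cell by $\arg\min_{x\in V}\sum_{v\in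 C_i}d(x,v)^\beta$ (for $\beta=\infty$, $\arg\min_{x\in V}\max_{v\in C_i}d(x,v)$); stop when the centers no longer change; output the clustering induced by the final centers. The cost of an output clustering $\{C_1,\dots,C_k\}$ is its Hamming distance to the target, $\min_\sigma\sum_{i=1}^k|C_i\setminus C^*_{\sigma(i)}|$ over permutations $\sigma$. $\mathtt{clus}_{\alpha,\beta}(\mathcal V)$ denotes the expected cost over the randomness of Phase 1. *)

theory Defs
  imports "HOL-Probability.Probability" "HOL-Library.While_Combinator"
begin

text \<open>
  The exponents \<open>\<alpha>\<close> and \<open>\<beta>\<close> are extended reals; \<open>\<infinity>\<close> is a genuine parameter value, so that
  \<open>{0..}\<close> and \<open>{1..}\<close> below contain it. Points are linearly ordered labels. The order is used only
  to make argmin single-valued: of several minimizers the one with the least label is taken.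
\<close>

definition first_arg_min :: "('a::linorder \<Rightarrow> real) \<Rightarrow> 'a set \<Rightarrow> 'a" where
  "first_arg_min f A = Min {x. is_arg_min f (\<lambda>x. x \<in> A) x}"


subsection \<open>Clusterings and their objectives\<close>

text \<open>The cells of a partition in the sense of \<^const>\<open>partition_on\<close> are nonempty.\<close>

definition is_clustering :: "'a set \<Rightarrow> nat \<Rightarrow> 'a set set \<Rightarrow> bool" where
  "is_clustering V k P \<longleftrightarrow> partition_on V P \<and> card P = k"

definition clustering_instance ::
    "'a set \<Rightarrow> ('a \<Rightarrow> 'a \<Rightarrow> real) \<Rightarrow> nat \<Rightarrow> 'a set set \<Rightarrow> bool" where
  "clustering_instance V d k T \<longleftrightarrow>
     finite V \<and> V \<noteq> {} \<and> Metric_space V d \<and> is_clustering V k T"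

definition objective ::
    "('a \<Rightarrow> 'a \<Rightarrow> real) \<Rightarrow> ereal \<Rightarrow> 'a set set \<Rightarrow> ('a set \<Rightarrow> 'a) \<Rightarrow> real" where
  "objective d \<beta> P c =
     (if \<beta> = \<infinity> then MAX S\<in>P. MAX v\<in>S. d v (c S)
      else (\<Sum>S\<in>P. \<Sum>v\<in>S. d v (c S) powr real_of_ereal \<beta>) powr (1 / real_of_ereal \<beta>))"

definition optimal_clustering ::
    "'a set \<Rightarrow> ('a \<Rightarrow> 'a \<Rightarrow> real) \<Rightarrow> nat \<Rightarrow> ereal \<Rightarrow> 'a set set \<Rightarrow> bool" where
  "optimal_clustering V d k \<beta> P \<longleftrightarrow>
     is_clustering V k P \<and>
     (\<exists>c \<in> P \<rightarrow> V. \<forall>Q c'. is_clustering V k Q \<and> c' \<in> Q \<rightarrow> V \<longrightarrow>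
        objective d \<beta> P c \<le> objective d \<beta> Q c')"


subsection \<open>Phase 1: sampling the initial centers\<close>

definition dmin :: "('a \<Rightarrow> 'a \<Rightarrow> real) \<Rightarrow> 'a \<Rightarrow> 'a set \<Rightarrow> real" where
  "dmin d v C = (MIN c\<in>C. d v c)"

text \<open>
  Since \<open>0 powr 0 = 0\<close>, an already chosen center has weight 0 also for \<open>\<alpha> = 0\<close>: this is the limit
  \<open>\<alpha> \<rightarrow> 0\<close>, i.e. uniform sampling without replacement.
\<close>

definition next_center ::
    "'a set \<Rightarrow> ('a \<Rightarrow> 'a \<Rightarrow> real) \<Rightarrow> ereal \<Rightarrow> 'a set \<Rightarrow> 'a pmf" where
  "next_center V d \<alpha> C =
     (if C = {} then pmf_of_set V
      else if \<alpha> = \<infinity> then pmf_of_set {v. is_arg_max (\<lambda>v. dmin d v C) (\<lambda>v. v \<in> V) v}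
      else embed_pmf (\<lambda>v. if v \<in> V
             then dmin d v C powr real_of_ereal \<alpha> / (\<Sum>u\<in>V. dmin d u C powr real_of_ereal \<alpha>)
             else 0))"

primrec seeding ::
    "'a set \<Rightarrow> ('a \<Rightarrow> 'a \<Rightarrow> real) \<Rightarrow> ereal \<Rightarrow> nat \<Rightarrow> 'a set pmf" where
  "seeding V d \<alpha> 0 = return_pmf {}"
| "seeding V d \<alpha> (Suc j) =
     bind_pmf (seeding V d \<alpha> j) (\<lambda>C. map_pmf (\<lambda>v. insert v C) (next_center V d \<alpha> C))"

text \<open>The sampling weights are a probability distribution as long as not all points are chosen.\<close>

lemma pmf_next_center:
  assumes "finite V" "Metric_space V d" "C \<noteq> {}" "C \<subset> V" "\<alpha> \<noteq> \<infinity>"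
  shows "pmf (next_center V d \<alpha> C) v =
    (if v \<in> V then dmin d v C powr real_of_ereal \<alpha> / (\<Sum>u\<in>V. dmin d u C powr real_of_ereal \<alpha>)
     else 0)"
proof -
  interpret Metric_space V d by fact
  let ?w = "\<lambda>v. dmin d v C powr real_of_ereal \<alpha>"
  let ?f = "\<lambda>v. if v \<in> V then ?w v / sum ?w V else 0"
  have finC: "finite C" using assms finite_subset by blast
  obtain x where x: "x \<in> V" "x \<notin> C" using assms by blast
  have "dmin d x C \<in> d x ` C" unfolding dmin_def using finC assms by (intro Min_in) auto
  then obtain c where "c \<in> C" "dmin d x C = d x c" by auto
  with x assms(4) have "dmin d x C \<noteq> 0" by auto
  then have "?w x > 0" by simp
  then have pos: "sum ?w V > 0" using x assms(1) by (intro sum_pos2) auto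
  have "(\<integral>\<^sup>+ v. ennreal (?f v) \<partial>count_space UNIV) = (\<integral>\<^sup>+ v. ennreal (?w v / sum ?w V) \<partial>count_space V)"
    by (subst (2) nn_integral_count_space_indicator)
       (auto intro!: nn_integral_cong simp: indicator_def)
  also have "\<dots> = (\<Sum>v\<in>V. ennreal (?w v / sum ?w V))"
    using assms(1) by (rule nn_integral_count_space_finite)
  also have "\<dots> = ennreal (\<Sum>v\<in>V. ?w v / sum ?w V)"
    using pos by (intro sum_ennreal) auto
  also have "(\<Sum>v\<in>V. ?w v / sum ?w V) = 1"
    using pos by (simp flip: sum_divide_distrib)
  finally have "(\<integral>\<^sup>+ v. ennreal (?f v) \<partial>count_space UNIV) = 1" by simp
  then have "pmf (embed_pmf ?f) v = ?f v"
    using pos by (intro pmf_embed_pmf) auto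
  then show ?thesis using assms unfolding next_center_def by simp
qed


subsection \<open>Phase 2: Lloyd's method\<close>

definition voronoi :: "'a::linorder set \<Rightarrow> ('a \<Rightarrow> 'a \<Rightarrow> real) \<Rightarrow> 'a set \<Rightarrow> 'a set set" where
  "voronoi V d C = (\<lambda>c. {v \<in> V. first_arg_min (d v) C = c}) ` C"

definition cell_cost :: "('a \<Rightarrow> 'a \<Rightarrow> real) \<Rightarrow> ereal \<Rightarrow> 'a set \<Rightarrow> 'a \<Rightarrow> real" where
  "cell_cost d \<beta> S x =
     (if \<beta> = \<infinity> then MAX v\<in>S. d x v else \<Sum>v\<in>S. d x v powr real_of_ereal \<beta>)"

definition lloyd_step ::
    "'a::linorder set \<Rightarrow> ('a \<Rightarrow> 'a \<Rightarrow> real) \<Rightarrow> ereal \<Rightarrow> 'a set \<Rightarrow> 'a set" where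
  "lloyd_step V d \<beta> C = (\<lambda>S. first_arg_min (cell_cost d \<beta> S) V) ` voronoi V d C"

definition lloyd ::
    "'a::linorder set \<Rightarrow> ('a \<Rightarrow> 'a \<Rightarrow> real) \<Rightarrow> ereal \<Rightarrow> 'a set \<Rightarrow> 'a set" where
  "lloyd V d \<beta> C = while (\<lambda>C. lloyd_step V d \<beta> C \<noteq> C) (lloyd_step V d \<beta>) C"


subsection \<open>Expected Hamming cost\<close>

text \<open>
  If the output \<open>P\<close> has as many cells as the target \<open>T\<close>, the injections are exactly the matchings
  given by permutations. Two cells may receive the same new center, so \<open>P\<close> can have fewer cells;
  injections then amount to padding \<open>P\<close> with empty clusters.
\<close>

definition hamming_cost :: "'a set set \<Rightarrow> 'a set set \<Rightarrow> nat" where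
  "hamming_cost T P = (MIN \<sigma> \<in> {\<sigma> \<in> P \<rightarrow>\<^sub>E T. inj_on \<sigma> P}. \<Sum>S\<in>P. card (S - \<sigma> S))"

definition clus ::
    "'a::linorder set \<Rightarrow> ('a \<Rightarrow> 'a \<Rightarrow> real) \<Rightarrow> nat \<Rightarrow> 'a set set \<Rightarrow> ereal \<Rightarrow> ereal \<Rightarrow> real" where
  "clus V d k T \<alpha> \<beta> =
     measure_pmf.expectation (seeding V d \<alpha> k)
       (\<lambda>C. real (hamming_cost T (voronoi V d (lloyd V d \<beta> C))))"

end

theory Submission
  imports Defs
begin

text \<open>
  All distances lie in \<open>[1, 2]\<close>, and a hub has distance 1 from every other point. There are two
  equilateral triangles of side \<open>u\<close>, at distance \<open>\<delta> > u\<close> from each other, and three points at the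
  largest distance \<open>\<phi>\<close> from everything but the hub. The Voronoi cell of the hub is large enough to
  have the hub as its center, so Lloyd's method ends with the hub and a single rival, or with the hub
  alone. Only a seed that meets both triangles is sensitive to \<open>\<beta>\<close>: one of the triangles is then a
  cell, and its center is a vertex (cost \<open>2 u\<^sup>\<beta>\<close>) or the hub (cost 3). These costs agree exactly at
  \<open>\<beta>\<^sup>*\<close> if \<open>u\<close> is \<open>3/2\<close> to the power \<open>1/\<beta>\<^sup>*\<close>. One triangle contains the singleton of the target,
  so that the vertex is the better choice there; in the other triangle the hub is. Ties are broken so
  that both better choices happen together only at \<open>\<beta> = \<beta>\<^sup>*\<close>. For \<open>\<beta>\<^sup>* = \<infinity>\<close> and \<open>u = 1\<close> the vertex
  wins for all \<open>\<beta> < \<infinity>\<close>, at \<open>\<infinity>\<close> there is a tie, and the second triangle alone decides.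

  The cost depends on \<open>\<alpha>\<close> through the probability of a seed that meets both triangles. Its distance
  \<open>\<delta>\<close> lies between the distances 1 and \<open>u\<close> on one side and \<open>\<phi>\<close> on the other, so that \<open>\<phi>\<close> can be
  chosen to put the peak at \<open>\<alpha>\<^sup>*\<close>; for \<open>\<alpha>\<^sup>* = \<infinity>\<close> take \<open>\<phi> = \<delta>\<close>. If \<open>\<beta>\<^sup>* < \<infinity>\<close>, the probability
  of the seed consisting of the hub and the singleton of the target is a perturbation.

  In any clustering into two cells, at least \<open>n - 2\<close> points have distance at least 1 from their centers;
  hence the singleton against the rest, with the hub as center, is optimal.
\<close>


subsection \<open>Minimizers, Lloyd steps and the Hamming cost for two centers\<close>

lemma first_arg_min_eqI:
  assumes "finite A" "c \<in> A"
    and "\<And>x. x \<in> A \<Longrightarrow> f c \<le> f x"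
    and "\<And>x. x \<in> A \<Longrightarrow> f x \<le> f c \<Longrightarrow> c \<le> x"
  shows "first_arg_min f A = c"
  unfolding first_arg_min_def
proof (rule Min_eqI)
  show "finite {x. is_arg_min f (\<lambda>x. x \<in> A) x}"
    by (rule finite_subset[OF _ assms(1)]) (auto simp: is_arg_min_def)
  show "c \<in> {x. is_arg_min f (\<lambda>x. x \<in> A) x}"
    using assms(2,3) by (auto simp: is_arg_min_linorder)
  show "c \<le> y" if "y \<in> {x. is_arg_min f (\<lambda>x. x \<in> A) x}" for y
    using that assms(2,4) by (auto simp: is_arg_min_linorder)
qed

lemma first_arg_min_singleton: "first_arg_min f {c} = c"
  by (rule first_arg_min_eqI) auto

lemma first_arg_min_pair:
  assumes "p < q"
  shows "first_arg_min f {p, q} = (if f q < f p then q else p)"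
  using assms by (intro first_arg_min_eqI) (auto split: if_splits)

lemma voronoi_singleton: "voronoi V d {c} = {V}"
  unfolding voronoi_def by (simp add: first_arg_min_singleton)

text \<open>Ties go to the smaller label \<open>p\<close>; hence the strict inequality for the cell
  of \<open>q\<close>, with the cell of \<open>p\<close> as its complement.\<close>

lemma voronoi_pair:
  assumes "p < q"
  shows "voronoi V d {p, q} = {V - {v \<in> V. d v q < d v p}, {v \<in> V. d v q < d v p}}"
proof -
  have "{v \<in> V. first_arg_min (d v) {p, q} = p} = V - {v \<in> V. d v q < d v p}"
    "{v \<in> V. first_arg_min (d v) {p, q} = q} = {v \<in> V. d v q < d v p}"
    using assms by (auto simp: first_arg_min_pair)
  then show ?thesis unfolding voronoi_def by simp
qed

lemma lloyd_step_pair: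
  assumes "p < q" "B = {v \<in> V. d v q < d v p}"
  shows "lloyd_step V d \<beta> {p, q} =
    {first_arg_min (cell_cost d \<beta> (V - B)) V, first_arg_min (cell_cost d \<beta> B) V}"
  unfolding lloyd_step_def voronoi_pair[OF assms(1)] assms(2) by simp

lemma lloyd_fixed: "lloyd_step V d \<beta> C = C \<Longrightarrow> lloyd V d \<beta> C = C"
  unfolding lloyd_def by (subst while_unfold) simp

text \<open>One unfolding of \<open>while\<close>, an equation that holds without a termination
  argument. Computing steps until a fixed point appears therefore determines
  \<open>lloyd\<close>.\<close>

lemma lloyd_lloyd_step: "lloyd V d \<beta> (lloyd_step V d \<beta> C) = lloyd V d \<beta> C"
proof (cases "lloyd_step V d \<beta> C = C")
  case False
  then show ?thesis unfolding lloyd_def by (subst (2) while_unfold) simp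
qed simp

text \<open>Covers the runs in which both centers merge into one.\<close>

lemma hamming_cost_singleton:
  assumes "X \<noteq> Y"
  shows "hamming_cost {X, Y} {A} = min (card (A - X)) (card (A - Y))"
proof -
  let ?f = "\<lambda>S\<in>{A}. X" and ?g = "\<lambda>S\<in>{A}. Y"
  have eq: "{\<sigma> \<in> {A} \<rightarrow>\<^sub>E {X, Y}. inj_on \<sigma> {A}} = {?f, ?g}" (is "?F = _")
  proof (intro equalityI subsetI)
    fix \<sigma> assume "\<sigma> \<in> ?F"
    then have "\<sigma> A = X \<or> \<sigma> A = Y" and ext: "\<sigma> \<in> extensional {A}"
      by (auto simp: PiE_def)
    then have "\<sigma> = ?f \<or> \<sigma> = ?g"
      using extensionalityI[OF ext restrict_extensional] by (metis restrict_apply singletonD)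
    then show "\<sigma> \<in> {?f, ?g}" by blast
  next
    show "\<sigma> \<in> ?F" if "\<sigma> \<in> {?f, ?g}" for \<sigma>
      using that by (elim insertE emptyE) simp_all
  qed
  show ?thesis unfolding hamming_cost_def eq by simp
qed

lemma hamming_cost_pair:
  assumes "X \<noteq> Y" "A \<noteq> B"
  shows "hamming_cost {X, Y} {A, B} =
    min (card (A - X) + card (B - Y)) (card (A - Y) + card (B - X))"
proof -
  let ?f = "\<lambda>S\<in>{A, B}. if S = A then X else Y" and ?g = "\<lambda>S\<in>{A, B}. if S = A then Y else X"
  have "{\<sigma> \<in> {A, B} \<rightarrow>\<^sub>E {X, Y}. inj_on \<sigma> {A, B}} = {?f, ?g}" (is "?F = _")
  proof (intro equalityI subsetI)
    fix \<sigma> assume \<sigma>: "\<sigma> \<in> ?F"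
    then have "\<sigma> A \<in> {X, Y}" "\<sigma> B \<in> {X, Y}" "\<sigma> A \<noteq> \<sigma> B" "\<sigma> \<in> extensional {A, B}"
      using assms(2) by (auto simp: PiE_def)
    then have "\<sigma> = ?f \<or> \<sigma> = ?g"
      by (auto simp: extensional_def fun_eq_iff)
    then show "\<sigma> \<in> {?f, ?g}" by blast
  next
    show "\<sigma> \<in> ?F" if "\<sigma> \<in> {?f, ?g}" for \<sigma>
      using that assms by (elim insertE emptyE) (simp_all add: inj_on_def)
  qed
  then show ?thesis using assms unfolding hamming_cost_def by simp
qed


subsection \<open>Seeding two centers\<close>

lemma dmin_singleton: "dmin d v {c} = d v c"
  by (simp add: dmin_def)

lemma clus_two_centers:
  assumes "finite V" "V \<noteq> {}" "\<And>v. v \<in> V \<Longrightarrow> set_pmf (next_center V d \<alpha> {v}) \<subseteq> V"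
  shows "clus V d 2 T \<alpha> \<beta> =
    (\<Sum>v\<in>V. \<Sum>w\<in>V. pmf (next_center V d \<alpha> {v}) w *
      real (hamming_cost T (voronoi V d (lloyd V d \<beta> {v, w})))) / real (card V)"
proof -
  define h where "h C = real (hamming_cost T (voronoi V d (lloyd V d \<beta> C)))" for C
  have seed: "seeding V d \<alpha> 2 =
      pmf_of_set V \<bind> (\<lambda>v. map_pmf (\<lambda>w. insert w {v}) (next_center V d \<alpha> {v}))"
    by (simp add: numeral_2_eq_2 bind_return_pmf next_center_def map_pmf_def bind_assoc_pmf)
  have fin: "finite (set_pmf (next_center V d \<alpha> {v}))" if "v \<in> V" for v
    using assms(1,3) that finite_subset by blast
  have "clus V d 2 T \<alpha> \<beta> = (\<Sum>v\<in>V. pmf (pmf_of_set V) v *\<^sub>R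
      measure_pmf.expectation (map_pmf (\<lambda>w. insert w {v}) (next_center V d \<alpha> {v})) h)"
    unfolding clus_def seed h_def[symmetric]
    by (rule pmf_expectation_bind) (use assms fin in auto)
  also have "\<dots> = (\<Sum>v\<in>V. (\<Sum>w\<in>V. pmf (next_center V d \<alpha> {v}) w * h {v, w}) / real (card V))"
  proof (rule sum.cong)
    fix v assume v: "v \<in> V"
    have "measure_pmf.expectation (next_center V d \<alpha> {v}) (\<lambda>w. h {w, v}) =
        (\<Sum>w\<in>V. h {w, v} * pmf (next_center V d \<alpha> {v}) w)"
      by (rule integral_measure_pmf_real) (use assms v in auto)
    then show "pmf (pmf_of_set V) v *\<^sub>R
        measure_pmf.expectation (map_pmf (\<lambda>w. insert w {v}) (next_center V d \<alpha> {v})) h =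
        (\<Sum>w\<in>V. pmf (next_center V d \<alpha> {v}) w * h {v, w}) / real (card V)"
      using assms v by (simp add: mult.commute insert_commute)
  qed simp
  finally show ?thesis by (simp add: h_def sum_divide_distrib)
qed


subsection \<open>The instance\<close>

text \<open>
  The hub is 1, the triangles are \<open>{0, 5, 6}\<close> and \<open>{2, 3, 4}\<close>, and the far points are 7, 8, 9. In the
  tie between a vertex and the hub, the label order favours 0 over the hub, and the hub over 2. The
  labels 5 and 6 have to exceed those of the other triangle: the cell of the smaller seed gets the hub.
\<close>

locale two_triangles =
  fixes u \<delta> \<phi> :: real
  assumes u_ge: "1 \<le> u" and u_less: "u < \<delta>" and \<delta>_le: "\<delta> \<le> \<phi>" and \<phi>_le: "\<phi> \<le> 2"
begin

abbreviation V :: "nat set" where "V \<equiv> {..<10}"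

abbreviation T :: "nat set set" where "T \<equiv> {{0}, V - {0}}"

definition dst :: "nat \<Rightarrow> nat \<Rightarrow> real" where
  "dst i j =
    (if i = j then 0
     else if i = 1 \<or> j = 1 then 1
     else if 7 \<le> i \<or> 7 \<le> j then \<phi>
     else if i \<in> {2, 3, 4} \<longleftrightarrow> j \<in> {2, 3, 4} then u
     else \<delta>)"

lemma V_eq: "V = {0, 1, 2, 3, 4, 5, 6, 7, 8, 9}"
  by auto

lemma dst_self [simp]: "dst i i = 0"
  by (simp add: dst_def)

lemma dst_commute: "dst i j = dst j i"
  by (auto simp: dst_def)

lemma dst_hub [simp]: "i \<noteq> Suc 0 \<Longrightarrow> dst i (Suc 0) = 1" "i \<noteq> Suc 0 \<Longrightarrow> dst (Suc 0) i = 1"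
  by (auto simp: dst_def)

lemma dst_bounds: "i \<noteq> j \<Longrightarrow> 1 \<le> dst i j \<and> dst i j \<le> 2"
  using u_ge u_less \<delta>_le \<phi>_le by (auto simp: dst_def)

lemma dst_nonneg: "0 \<le> dst i j"
  using dst_bounds[of i j] by (cases "i = j") auto

lemma Metric_space_dst: "Metric_space V dst"
proof
  show "0 \<le> dst x y" for x y by (rule dst_nonneg)
  show "dst x y = dst y x" for x y by (rule dst_commute)
  show "dst x y = 0 \<longleftrightarrow> x = y" for x y
    using dst_bounds[of x y] by (cases "x = y") auto
  \<comment> \<open>Nonzero distances lie in \<open>[1, 2]\<close>, so two of them add up to at
    least 2.\<close>
  show "dst x z \<le> dst x y + dst y z" for x y z
    using dst_bounds[of x y] dst_bounds[of y z] dst_bounds[of x z] dst_nonneg[of x y] dst_nonneg[of y z]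
    by (cases "x = y"; cases "y = z"; cases "x = z") auto
qed

section \<open>Optimality of the target\<close>

lemma is_clustering_T: "is_clustering V 2 T"
proof -
  have "{0} \<noteq> V - {0}" "V - {0} \<noteq> {}"
    by (auto simp: V_eq)
  then show ?thesis
    by (auto simp: is_clustering_def partition_on_def disjoint_def)
qed

lemma clustering_instance_T: "clustering_instance V dst 2 T"
  using Metric_space_dst is_clustering_T by (simp add: clustering_instance_def lessThan_empty_iff)

text \<open>At most one point of \<open>S\<close> equals \<open>c\<close>; every other point
  contributes at least 1.\<close>

lemma sum_dst_powr_ge:
  assumes "finite S" "0 \<le> b"
  shows "real (card S) - 1 \<le> (\<Sum>v\<in>S. dst v c powr b)"
proof -
  have "real (card S) - 1 \<le> (\<Sum>v\<in>S - {c}. 1::real)"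
    using assms by (cases "c \<in> S") (auto simp: card_Diff_singleton_if of_nat_diff Suc_le_eq card_gt_0_iff)
  also have "\<dots> \<le> (\<Sum>v\<in>S - {c}. dst v c powr b)"
    using dst_bounds assms(2) by (intro sum_mono ge_one_powr_ge_zero) auto
  also have "\<dots> \<le> (\<Sum>v\<in>S. dst v c powr b)"
    using assms by (intro sum_mono2) auto
  finally show ?thesis .
qed

lemma optimal_T:
  assumes "1 \<le> \<beta>"
  shows "optimal_clustering V dst 2 \<beta> T"
proof -
  define c :: "nat set \<Rightarrow> nat" where "c S = (if S = {0} then 0 else 1)" for S
  have ne: "{0} \<noteq> V - {0}" by auto
  have c: "c {0} = 0" "c (V - {0}) = 1" using ne by (auto simp: c_def)
  have "objective dst \<beta> T c \<le> objective dst \<beta> Q c'"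
    if Q: "is_clustering V 2 Q" for Q c'
  proof -
    have part: "\<Union>Q = V" "disjoint Q" "{} \<notin> Q" "card Q = 2"
      using Q by (auto simp: is_clustering_def partition_on_def)
    have finQ: "finite Q" using part(4) by (metis card.infinite zero_neq_numeral)
    have finS: "finite S" if "S \<in> Q" for S
      using that part(1) finite_subset[of S V] by blast
    have "(\<Sum>S\<in>Q. card S) = card (\<Union>Q)"
      by (rule card_Union_disjoint[symmetric]) (use part finS in \<open>auto simp: pairwise_def disjoint_def disjnt_def\<close>)
    then have cards: "(\<Sum>S\<in>Q. card S) = 10" using part(1) by simp
    show ?thesis
    proof (cases "\<beta> = \<infinity>")
      case True
      have "\<exists>S\<in>Q. 2 \<le> card S"
      proof (rule ccontr)
        assume "\<not> ?thesis"
        then have "(\<Sum>S\<in>Q. card S) \<le> (\<Sum>S\<in>Q. 1)" by (intro sum_mono) auto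
        then show False using cards part(4) by simp
      qed
      then obtain S where S: "S \<in> Q" "2 \<le> card S" by blast
      then have "S - {c' S} \<noteq> {}"
        using card_mono[of "{c' S}" S] by auto
      then obtain v where v: "v \<in> S" "v \<noteq> c' S" by blast
      have "1 \<le> dst v (c' S)" using v dst_bounds by blast
      also have "\<dots> \<le> (MAX v\<in>S. dst v (c' S))"
        using v finS[OF S(1)] by (intro Max_ge) auto
      also have "\<dots> \<le> (MAX S\<in>Q. MAX v\<in>S. dst v (c' S))"
        using S finQ by (intro Max_ge) auto
      finally have *: "1 \<le> objective dst \<beta> Q c'" using True by (simp add: objective_def)
      have "(MAX v\<in>V - {0}. dst v 1) \<le> 1"
        by (simp add: V_eq)
      then have "objective dst \<beta> T c \<le> 1"
        using True ne by (simp only: objective_def c if_True) (simp add: c)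
      with * show ?thesis by simp
    next
      case False
      define b where "b = real_of_ereal \<beta>"
      have b: "1 \<le> b" using assms False by (cases \<beta>) (auto simp: b_def)
      have "(\<Sum>v\<in>V - {0}. dst v 1 powr b) = (\<Sum>v\<in>V - {0}. if v = 1 then 0 else 1)"
        by (intro sum.cong) auto
      also have "\<dots> = 8" by (simp add: V_eq)
      finally have "(\<Sum>S\<in>T. \<Sum>v\<in>S. dst v (c S) powr b) = 8"
        using ne by (simp add: c)
      \<comment> \<open>Ten points minus one per cell: the lower bound for any \<open>Q\<close>
        equals the cost of \<open>T\<close>.\<close>
      also have "8 = (\<Sum>S\<in>Q. real (card S) - 1)"
        using cards part(4) by (simp add: sum_subtractf flip: of_nat_sum)
      also have "\<dots> \<le> (\<Sum>S\<in>Q. \<Sum>v\<in>S. dst v (c' S) powr b)"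
        using b finS by (intro sum_mono sum_dst_powr_ge) auto
      finally have "(\<Sum>S\<in>T. \<Sum>v\<in>S. dst v (c S) powr b) powr (1 / b) \<le>
          (\<Sum>S\<in>Q. \<Sum>v\<in>S. dst v (c' S) powr b) powr (1 / b)"
        using b by (intro powr_mono2 sum_nonneg) simp_all
      then show ?thesis using False by (simp only: objective_def b_def if_False)
    qed
  qed
  moreover have "c \<in> T \<rightarrow> V" by (auto simp: c_def)
  ultimately show ?thesis
    using is_clustering_T unfolding optimal_clustering_def by blast
qed


section \<open>Voronoi cells of two centers\<close>

lemma cell_of_hub_rival:
  assumes "q \<in> V" "1 < q"
  shows "{v \<in> V. dst v q < dst v 1} = {q}"
proof (intro equalityI subsetI)
  fix v assume v: "v \<in> {v \<in> V. dst v q < dst v 1}"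
  have "dst v 1 \<le> 1" by (cases "v = 1") auto
  with v have "dst v q < 1" by simp
  then show "v \<in> {q}" using dst_bounds[of v q] by (cases "v = q") auto
qed (use assms in auto)

text \<open>Two vertices of one triangle are equidistant from every other point, and
  \<open>p\<close> wins the ties.\<close>

lemma cell_of_same_triangle:
  assumes "p < q" "{p, q} \<subseteq> {0, 5, 6} \<or> {p, q} \<subseteq> {2, 3, 4}"
  shows "{v \<in> V. dst v q < dst v p} = {q}"
proof -
  have "dst v q < dst v p \<longleftrightarrow> v = q" if "v \<in> V" for v
    using that assms u_ge u_less \<delta>_le unfolding V_eq
    by (elim insertE emptyE) (auto simp: dst_def)
  moreover have "q \<in> V" using assms by auto
  ultimately show ?thesis by blast
qed

text \<open>No point other than \<open>q\<close> is closer to \<open>q\<close> than to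
  \<open>p\<close>, since \<open>\<phi>\<close> is the largest distance and the hub is at distance 1
  from \<open>q\<close>; \<open>p\<close> wins the ties.\<close>

lemma cell_of_far:
  assumes "p < q" "7 \<le> q" "q < 10"
  shows "{v \<in> V. dst v q < dst v p} = {q}"
proof -
  have "dst v q < dst v p \<longleftrightarrow> v = q" for v
    using assms u_ge u_less \<delta>_le by (auto simp: dst_def)
  then show ?thesis using assms by auto
qed

text \<open>Since \<open>u < \<delta>\<close>, each triangle goes to its own seed. The hub and the
  far points tie and go to the smaller seed.\<close>

lemma cell_of_other_triangle:
  shows "p \<in> {0, 5, 6} \<Longrightarrow> q \<in> {2, 3, 4} \<Longrightarrow> p < q \<Longrightarrow> {v \<in> V. dst v q < dst v p} = {2, 3, 4}"
    and "p \<in> {2, 3, 4} \<Longrightarrow> q \<in> {0, 5, 6} \<Longrightarrow> p < q \<Longrightarrow> {v \<in> V. dst v q < dst v p} = {0, 5, 6}"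
proof -
  assume pq: "p \<in> {0, 5, 6}" "q \<in> {2, 3, 4}" "p < q"
  have "dst v q < dst v p \<longleftrightarrow> v \<in> {2, 3, 4}" if "v \<in> V" for v
    using that pq u_ge u_less \<delta>_le unfolding V_eq
    by (elim insertE emptyE) (simp_all add: dst_def)
  moreover have "{2, 3, 4} \<subseteq> V" by simp
  ultimately show "{v \<in> V. dst v q < dst v p} = {2, 3, 4}" by blast
next
  assume pq: "p \<in> {2, 3, 4}" "q \<in> {0, 5, 6}" "p < q"
  have "dst v q < dst v p \<longleftrightarrow> v \<in> {0, 5, 6}" if "v \<in> V" for v
    using that pq u_ge u_less \<delta>_le unfolding V_eq
    by (elim insertE emptyE) (simp_all add: dst_def)
  moreover have "{0, 5, 6} \<subseteq> V" by simp
  ultimately show "{v \<in> V. dst v q < dst v p} = {0, 5, 6}" by blast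
qed

text \<open>For \<open>u = 1\<close> the ties in the triangle of the point 0 go to 0, the smaller label.\<close>

lemma cell_of_hub:
  "{v \<in> V. dst v 1 < dst v 0} = (if u = 1 then V - {0, 5, 6} else V - {0})"
proof -
  have "dst v 1 < dst v 0 \<longleftrightarrow> v \<noteq> 0 \<and> (u = 1 \<longrightarrow> v \<notin> {5, 6})" if "v \<in> V" for v
    using that u_ge u_less \<delta>_le unfolding V_eq
    by (elim insertE emptyE) (auto simp: dst_def)
  then show ?thesis by auto
qed

section \<open>Centers of the cells\<close>

lemma cell_cost_infty: "cell_cost dst \<infinity> S x = (MAX v\<in>S. dst x v)"
  by (simp add: cell_cost_def)

lemma cell_cost_finite:
  "\<beta> \<noteq> \<infinity> \<Longrightarrow> cell_cost dst \<beta> S x = (\<Sum>v\<in>S. dst x v powr real_of_ereal \<beta>)"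
  by (simp add: cell_cost_def)

lemma center_singleton:
  assumes "q \<in> V"
  shows "first_arg_min (cell_cost dst \<beta> {q}) V = q"
proof (rule first_arg_min_eqI)
  have less: "cell_cost dst \<beta> {q} q < cell_cost dst \<beta> {q} x" if "x \<noteq> q" for x
    using dst_bounds[OF that] by (simp add: cell_cost_def)
  show "cell_cost dst \<beta> {q} q \<le> cell_cost dst \<beta> {q} x"
    and "cell_cost dst \<beta> {q} x \<le> cell_cost dst \<beta> {q} q \<Longrightarrow> q \<le> x" for x
    using less[of x] by (cases "x = q"; simp)+
qed (use assms in auto)

text \<open>The hub has distance 1 from all other points of \<open>A\<close>. Any other
  \<open>x\<close> has distance at least 1 from every point but itself, and distance
  \<open>\<phi> > 1\<close> from some far point of \<open>A\<close> other than \<open>x\<close>,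
  because \<open>A\<close> contains two of them.\<close>

lemma center_hub:
  assumes "A \<subseteq> V" "1 \<in> A" "2 \<le> card (A \<inter> {7, 8, 9})" "1 \<le> \<beta>"
  shows "first_arg_min (cell_cost dst \<beta> A) V = 1"
proof -
  have finA: "finite A" using assms(1) finite_subset by blast
  have "cell_cost dst \<beta> A 1 < cell_cost dst \<beta> A x" if x: "x \<in> V" "x \<noteq> 1" for x
  proof -
    have "\<not> A \<inter> {7, 8, 9} \<subseteq> {x}"
      using assms(3) card_mono[of "{x}" "A \<inter> {7, 8, 9}"] by auto
    then obtain g where g: "g \<in> A" "g \<in> {7, 8, 9}" "g \<noteq> x" by blast
    have dg: "1 < dst x g" using g x u_ge u_less \<delta>_le by (auto simp: dst_def)
    show ?thesis
    proof (cases "\<beta> = \<infinity>")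
      case True
      have "dst 1 v \<le> 1" for v by (cases "v = 1") auto
      then have "(MAX v\<in>A. dst 1 v) \<le> 1"
        using assms(2) finA by (subst Max_le_iff) auto
      also have "1 < dst x g" by (rule dg)
      also have "dst x g \<le> (MAX v\<in>A. dst x v)"
        using g finA by (intro Max_ge) auto
      finally show ?thesis using True by (simp add: cell_cost_infty)
    next
      case False
      define b where "b = real_of_ereal \<beta>"
      have b: "1 \<le> b" using assms(4) False by (cases \<beta>) (auto simp: b_def)
      have "(\<Sum>v\<in>A. dst 1 v powr b) = (\<Sum>v\<in>A - {1}. dst 1 v powr b)"
        by (rule sum.mono_neutral_right) (use finA in auto)
      also have "\<dots> = (\<Sum>v\<in>A - {1}. 1)" by (intro sum.cong) auto
      also have "\<dots> \<le> (\<Sum>v\<in>A - {x}. 1::real)"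
        using assms(2) finA by (auto simp: card_Diff_singleton_if)
      also have "\<dots> < (\<Sum>v\<in>A - {x}. dst x v powr b)"
      proof (rule sum_strict_mono_ex1)
        show "\<forall>v\<in>A - {x}. 1 \<le> dst x v powr b"
          using dst_bounds b by (auto intro!: ge_one_powr_ge_zero)
        show "\<exists>v\<in>A - {x}. 1 < dst x v powr b"
          using g dg b by (intro bexI[of _ g] gr_one_powr) auto
      qed (use finA in auto)
      also have "\<dots> \<le> (\<Sum>v\<in>A. dst x v powr b)"
        using finA by (intro sum_mono2) auto
      finally show ?thesis using False by (simp add: cell_cost_finite b_def)
    qed
  qed
  then show ?thesis
    by (intro first_arg_min_eqI) (auto simp: less_le_not_le intro: less_imp_le)
qed

text \<open>The cost of a triangle as a cell, with one of its vertices as center;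
  \<open>hub_cost\<close> is the cost with the hub as center.\<close>

definition side_cost :: "ereal \<Rightarrow> real" where
  "side_cost \<beta> = (if \<beta> = \<infinity> then u else 2 * u powr real_of_ereal \<beta>)"

definition hub_cost :: "ereal \<Rightarrow> real" where
  "hub_cost \<beta> = (if \<beta> = \<infinity> then 1 else 3)"

text \<open>The vertices cost the same, and any point outside the triangle except the hub costs more
  than the hub, as \<open>1 < \<delta> \<le> \<phi>\<close>. The labels 0, 1, 2 break the tie of
  vertex and hub; hence \<open>\<le>\<close> in one claim and \<open><\<close> in the other.\<close>

lemma center_triangle:
  assumes "1 \<le> \<beta>"
  shows "first_arg_min (cell_cost dst \<beta> {0, 5, 6}) V = (if side_cost \<beta> \<le> hub_cost \<beta> then 0 else 1)"
    and "first_arg_min (cell_cost dst \<beta> {2, 3, 4}) V = (if side_cost \<beta> < hub_cost \<beta> then 2 else 1)"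
proof -
  have b: "0 < real_of_ereal \<beta>" if "\<beta> \<noteq> \<infinity>"
    using assms that by (cases \<beta>) auto
  have gt: "1 < \<delta> powr real_of_ereal \<beta>" "1 < \<phi> powr real_of_ereal \<beta>" if "\<beta> \<noteq> \<infinity>"
    using b[OF that] u_ge u_less \<delta>_le by (auto intro!: gr_one_powr)
  have in1: "cell_cost dst \<beta> {0, 5, 6} x = side_cost \<beta>" if "x \<in> {0, 5, 6}" for x
    using that u_ge by (auto simp: cell_cost_def side_cost_def dst_def)
  have in2: "cell_cost dst \<beta> {2, 3, 4} x = side_cost \<beta>" if "x \<in> {2, 3, 4}" for x
    using that u_ge by (auto simp: cell_cost_def side_cost_def dst_def)
  have hub: "cell_cost dst \<beta> {0, 5, 6} 1 = hub_cost \<beta>" "cell_cost dst \<beta> {2, 3, 4} 1 = hub_cost \<beta>"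
    by (auto simp: cell_cost_def hub_cost_def dst_def)
  have out1: "hub_cost \<beta> < cell_cost dst \<beta> {0, 5, 6} x" if "x \<in> {2, 3, 4, 7, 8, 9}" for x
    using that gt u_ge u_less \<delta>_le by (auto simp: cell_cost_def hub_cost_def dst_def)
  have out2: "hub_cost \<beta> < cell_cost dst \<beta> {2, 3, 4} x" if "x \<in> {0, 5, 6, 7, 8, 9}" for x
    using that gt u_ge u_less \<delta>_le by (auto simp: cell_cost_def hub_cost_def dst_def)
  have V1: "x \<in> {0, 5, 6} \<or> x = 1 \<or> x \<in> {2, 3, 4, 7, 8, 9}" if "x \<in> V" for x
    using that by (auto simp: V_eq)
  have V2: "x \<in> {2, 3, 4} \<or> x = 1 \<or> x \<in> {0, 5, 6, 7, 8, 9}" if "x \<in> V" for x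
    using that by (auto simp: V_eq)
  show "first_arg_min (cell_cost dst \<beta> {0, 5, 6}) V = (if side_cost \<beta> \<le> hub_cost \<beta> then 0 else 1)"
  proof (rule first_arg_min_eqI)
    fix x assume "x \<in> V"
    note this[THEN V1]
    then show "cell_cost dst \<beta> {0, 5, 6} (if side_cost \<beta> \<le> hub_cost \<beta> then 0 else 1)
        \<le> cell_cost dst \<beta> {0, 5, 6} x"
      using in1[of 0] in1[of x] hub out1[of x] by (auto split del: if_split split: if_split)
    show "(if side_cost \<beta> \<le> hub_cost \<beta> then 0 else 1) \<le> x"
      if "cell_cost dst \<beta> {0, 5, 6} x
        \<le> cell_cost dst \<beta> {0, 5, 6} (if side_cost \<beta> \<le> hub_cost \<beta> then 0 else 1)"
      using that in1[of 0] hub by (cases "x = 0") (auto split: if_splits)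
  qed auto
  show "first_arg_min (cell_cost dst \<beta> {2, 3, 4}) V = (if side_cost \<beta> < hub_cost \<beta> then 2 else 1)"
  proof (rule first_arg_min_eqI)
    fix x assume "x \<in> V"
    note x = this[THEN V2]
    then show "cell_cost dst \<beta> {2, 3, 4} (if side_cost \<beta> < hub_cost \<beta> then 2 else 1)
        \<le> cell_cost dst \<beta> {2, 3, 4} x"
      using in2[of 2] in2[of x] hub out2[of x] by (auto split del: if_split split: if_split)
    show "(if side_cost \<beta> < hub_cost \<beta> then 2 else 1) \<le> x"
      if "cell_cost dst \<beta> {2, 3, 4} x
        \<le> cell_cost dst \<beta> {2, 3, 4} (if side_cost \<beta> < hub_cost \<beta> then 2 else 1)"
      using that x in2[of 2] hub out2[of x] by (auto split: if_splits)
  qed auto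
qed


section \<open>Runs ending with the hub, alone or with a rival\<close>

lemma lloyd_hub_alone:
  assumes "1 \<le> \<beta>"
  shows "lloyd V dst \<beta> {1} = {1}"
  by (rule lloyd_fixed)
    (simp add: lloyd_step_def voronoi_singleton center_hub[OF _ _ _ assms] Int_insert_right)

lemma lloyd_hub_rival:
  assumes "q \<in> V" "1 < q" "1 \<le> \<beta>"
  shows "lloyd V dst \<beta> {1, q} = {1, q}"
proof (rule lloyd_fixed)
  \<comment> \<open>Even if \<open>q\<close> is a far point, two far points remain in the other
    cell, as \<open>center_hub\<close> requires.\<close>
  have "{7, 8, 9} - {q} \<subseteq> (V - {q}) \<inter> {7, 8, 9}" by auto
  then have "card ({7, 8, 9} - {q}) \<le> card ((V - {q}) \<inter> {7, 8, 9})"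
    by (intro card_mono) auto
  then have "first_arg_min (cell_cost dst \<beta> (V - {q})) V = 1"
    using assms by (intro center_hub) (auto simp: card_Diff_singleton_if split: if_splits)
  then show "lloyd_step V dst \<beta> {1, q} = {1, q}"
    by (simp only: lloyd_step_pair[OF assms(2) cell_of_hub_rival[OF assms(1,2), symmetric]]
        center_singleton[OF assms(1)])
qed

lemma lloyd_separated:
  assumes "p < q" "q \<in> V" "1 < q" "{v \<in> V. dst v q < dst v p} = {q}" "1 \<le> \<beta>"
  shows "lloyd V dst \<beta> {p, q} = {1, q}"
proof -
  have "{7, 8, 9} - {q} \<subseteq> (V - {q}) \<inter> {7, 8, 9}" by auto
  then have "card ({7, 8, 9} - {q}) \<le> card ((V - {q}) \<inter> {7, 8, 9})"
    by (intro card_mono) auto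
  then have "first_arg_min (cell_cost dst \<beta> (V - {q})) V = 1"
    using assms by (intro center_hub) (auto simp: card_Diff_singleton_if split: if_splits)
  then have "lloyd_step V dst \<beta> {p, q} = {1, q}"
    by (simp only: lloyd_step_pair[OF assms(1) assms(4)[symmetric]] center_singleton[OF assms(2)])
  then show ?thesis
    using lloyd_lloyd_step[of V dst \<beta> "{p, q}"] lloyd_hub_rival assms by simp
qed

end

section \<open>Calibration of \<open>u\<close> to \<open>\<beta>s\<close>, and the runs sensitive to
  \<open>\<beta>\<close>\<close>

locale tuned_triangles = two_triangles +
  fixes \<beta>s :: ereal
  assumes \<beta>s_ge: "1 \<le> \<beta>s"
    and u_eq: "u = (if \<beta>s = \<infinity> then 1 else (3 / 2) powr (1 / real_of_ereal \<beta>s))"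
begin

lemma u_eq_1_iff: "u = 1 \<longleftrightarrow> \<beta>s = \<infinity>"
proof (cases \<beta>s)
  case (real b)
  then have b: "1 \<le> b" using \<beta>s_ge by simp
  then have "1 < (3 / 2 :: real) powr (1 / b)" by (intro gr_one_powr) auto
  then show ?thesis using real u_eq b by simp
qed (use \<beta>s_ge u_eq in auto)

text \<open>For finite exponents \<open>u powr \<beta>\<close> is \<open>3 / 2\<close> to the power
  \<open>\<beta> / \<beta>s\<close>, to be compared with \<open>3 / 2\<close>. If only
  \<open>\<beta>s\<close> is infinite, the comparison is 2 against 3; if
  \<open>\<beta> = \<infinity>\<close>, it is \<open>u\<close> against 1.\<close>

lemma side_cost_hub_cost:
  assumes "1 \<le> \<beta>"
  shows "side_cost \<beta> \<le> hub_cost \<beta> \<longleftrightarrow> \<beta> \<le> \<beta>s"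
    and "side_cost \<beta> < hub_cost \<beta> \<longleftrightarrow> \<beta> < \<beta>s"
proof -
  consider "\<beta> = \<infinity>" | b where "\<beta> = ereal b" "1 \<le> b"
    using assms by (cases \<beta>) auto
  then have "(side_cost \<beta> \<le> hub_cost \<beta> \<longleftrightarrow> \<beta> \<le> \<beta>s) \<and> (side_cost \<beta> < hub_cost \<beta> \<longleftrightarrow> \<beta> < \<beta>s)"
  proof cases
    case 1
    then show ?thesis
      using u_ge u_eq_1_iff by (auto simp: side_cost_def hub_cost_def)
  next
    case (2 b)
    show ?thesis
    proof (cases \<beta>s)
      case (real bs)
      then have bs: "1 \<le> bs" using \<beta>s_ge by simp
      have "u powr b = (3 / 2) powr (b / bs)"
        using real by (subst u_eq) (simp add: powr_powr)
      then have "side_cost \<beta> = 2 * (3 / 2) powr (b / bs)"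
        using 2 by (simp add: side_cost_def)
      moreover have "(3 / 2 :: real) powr (b / bs) \<le> (3 / 2) powr 1 \<longleftrightarrow> b / bs \<le> 1"
        "(3 / 2 :: real) powr (b / bs) < (3 / 2) powr 1 \<longleftrightarrow> b / bs < 1"
        by (subst powr_le_cancel_iff powr_less_cancel_iff; simp)+
      ultimately show ?thesis
        using real 2 bs by (auto simp: hub_cost_def)
    next
      case PInf
      then have "u powr b = 1" using u_eq_1_iff by simp
      then show ?thesis using 2 PInf by (simp add: side_cost_def hub_cost_def)
    qed (use \<beta>s_ge in auto)
  qed
  then show "side_cost \<beta> \<le> hub_cost \<beta> \<longleftrightarrow> \<beta> \<le> \<beta>s"
    and "side_cost \<beta> < hub_cost \<beta> \<longleftrightarrow> \<beta> < \<beta>s" by auto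
qed

text \<open>If \<open>u = 1\<close>, the cell of 0 is its whole triangle; 0 stays its center because
  then \<open>\<beta>s = \<infinity>\<close>, so that \<open>\<beta> \<le> \<beta>s\<close>.\<close>

lemma lloyd_hub_0:
  assumes "1 \<le> \<beta>"
  shows "lloyd V dst \<beta> {0, 1} = {0, 1}"
proof (rule lloyd_fixed)
  have hub: "first_arg_min (cell_cost dst \<beta> A) V = 1" if "A = V - {0} \<or> A = V - {0, 5, 6}" for A
  proof (rule center_hub)
    have "A \<inter> {7, 8, 9} = {7, 8, 9}" using that by auto
    then show "2 \<le> card (A \<inter> {7, 8, 9})" by simp
  qed (use that assms in auto)
  have rest: "V - (V - {0}) = {0}" "V - (V - {0, 5, 6}) = {0, 5, 6}" by auto
  have "first_arg_min (cell_cost dst \<beta> {0, 5, 6}) V = 0" if "u = 1"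
    using that center_triangle(1)[OF assms] side_cost_hub_cost(1)[OF assms] u_eq_1_iff by simp
  moreover have "first_arg_min (cell_cost dst \<beta> {0}) V = 0"
    by (rule center_singleton) simp
  ultimately show "lloyd_step V dst \<beta> {0, 1} = {0, 1}"
    unfolding lloyd_step_pair[OF zero_less_one cell_of_hub[symmetric]]
    using hub[of "V - {0}"] hub[of "V - {0, 5, 6}"] by (cases "u = 1") (simp_all only: rest if_True if_False simp_thms)
qed

text \<open>After one step the cell of \<open>p\<close> has the hub as center, and the triangle of
  \<open>q\<close> a vertex or again the hub, in which case the centers merge. The result is already
  stable.\<close>

lemma lloyd_other_triangle:
  assumes "p < q" "1 \<le> \<beta>"
  shows "p \<in> {0, 5, 6} \<Longrightarrow> q \<in> {2, 3, 4} \<Longrightarrow>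
      lloyd V dst \<beta> {p, q} = (if \<beta> < \<beta>s then {1, 2} else {1})"
    and "p \<in> {2, 3, 4} \<Longrightarrow> q \<in> {0, 5, 6} \<Longrightarrow>
      lloyd V dst \<beta> {p, q} = (if \<beta> \<le> \<beta>s then {0, 1} else {1})"
proof -
  have hub: "first_arg_min (cell_cost dst \<beta> (V - B)) V = 1" if "B = {2, 3, 4} \<or> B = {0, 5, 6}" for B
  proof (rule center_hub)
    have "(V - B) \<inter> {7, 8, 9} = {7, 8, 9}" using that by auto
    then show "2 \<le> card ((V - B) \<inter> {7, 8, 9})" by simp
  qed (use that assms in auto)
  {
    assume pq: "p \<in> {0, 5, 6}" "q \<in> {2, 3, 4}"
    have step: "lloyd_step V dst \<beta> {p, q} = (if \<beta> < \<beta>s then {1, 2} else {1})"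
      unfolding lloyd_step_pair[OF assms(1) cell_of_other_triangle(1)[OF pq assms(1), symmetric]]
      using hub[of "{2, 3, 4}"] center_triangle(2)[OF assms(2)] side_cost_hub_cost(2)[OF assms(2)]
      by simp
    have "lloyd V dst \<beta> (if \<beta> < \<beta>s then {1, 2} else {1}) = (if \<beta> < \<beta>s then {1, 2} else {1})"
      using lloyd_hub_alone[OF assms(2)] lloyd_hub_rival[of 2 \<beta>] assms(2) by simp
    then show "lloyd V dst \<beta> {p, q} = (if \<beta> < \<beta>s then {1, 2} else {1})"
      unfolding step[symmetric] lloyd_lloyd_step .
  next
    assume pq: "p \<in> {2, 3, 4}" "q \<in> {0, 5, 6}"
    have step: "lloyd_step V dst \<beta> {p, q} = (if \<beta> \<le> \<beta>s then {0, 1} else {1})"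
      unfolding lloyd_step_pair[OF assms(1) cell_of_other_triangle(2)[OF pq assms(1), symmetric]]
      using hub[of "{0, 5, 6}"] center_triangle(1)[OF assms(2)] side_cost_hub_cost(1)[OF assms(2)]
      by (simp add: insert_commute)
    have "lloyd V dst \<beta> (if \<beta> \<le> \<beta>s then {0, 1} else {1}) = (if \<beta> \<le> \<beta>s then {0, 1} else {1})"
      using lloyd_hub_alone[OF assms(2)] lloyd_hub_0[OF assms(2)] by simp
    then show "lloyd V dst \<beta> {p, q} = (if \<beta> \<le> \<beta>s then {0, 1} else {1})"
      unfolding step[symmetric] lloyd_lloyd_step .
  }
qed

section \<open>Hamming cost for every seed\<close>

definition outcome :: "ereal \<Rightarrow> nat set \<Rightarrow> nat" where
  "outcome \<beta> C = hamming_cost T (voronoi V dst (lloyd V dst \<beta> C))"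

lemma T_distinct: "{0} \<noteq> V - {0}"
  by auto

lemma hamming_cost_hub_alone: "hamming_cost T (voronoi V dst {1}) = 1"
proof -
  have "card (V - {0}) = 9" "V - (V - {0}) = {0}" by auto
  then show ?thesis
    by (simp only: voronoi_singleton hamming_cost_singleton[OF T_distinct]) simp
qed

text \<open>The best matching sends \<open>{q}\<close> to \<open>{0}\<close> and misplaces exactly 0
  and \<open>q\<close>.\<close>

lemma hamming_cost_hub_rival:
  assumes "q \<in> V" "1 < q"
  shows "hamming_cost T (voronoi V dst {1, q}) = 2"
proof -
  have sets: "V - {q} - {0} = V - {0, q}" "{q} - (V - {0}) = {}" "V - {q} - (V - {0}) = {0}"
    "{q} - {0} = {q}" using assms by auto
  have "card (V - {0, q}) = 8" using assms by (subst card_Diff_subset) auto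
  moreover have ne: "V - {q} \<noteq> {q}" using assms by auto
  ultimately show ?thesis
    by (simp only: voronoi_pair[OF assms(2)] cell_of_hub_rival[OF assms]
        hamming_cost_pair[OF T_distinct ne] sets) simp
qed

text \<open>For \<open>\<beta>s = \<infinity>\<close> the cell of 0 is its triangle, with 5 and 6
  misplaced; otherwise the target itself is reached.\<close>

lemma hamming_cost_hub_0:
  "hamming_cost T (voronoi V dst {0, 1}) = (if \<beta>s = \<infinity> then 2 else 0)"
proof (cases "u = 1")
  case True
  have ne: "{0, 5, 6} \<noteq> V - {0, 5, 6}" by blast
  have sets: "V - (V - {0, 5, 6}) = {0, 5, 6}" "{0, 5, 6} - {0::nat} = {5, 6}" "V - {0, 5, 6} - (V - {0}) = {}"
    "{0, 5, 6} - (V - {0}) = {0}" "V - {0, 5, 6} - {0} = V - {0, 5, 6}" by auto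
  have "card (V - {0, 5, 6}) = 7" by (subst card_Diff_subset) auto
  then have "hamming_cost T {{0, 5, 6}, V - {0, 5, 6}} = 2"
    by (simp only: hamming_cost_pair[OF T_distinct ne] sets) simp
  moreover have "\<beta>s = \<infinity>" using True u_eq_1_iff by blast
  ultimately show ?thesis
    by (simp only: voronoi_pair[OF zero_less_one] cell_of_hub sets(1) if_P[OF True] if_True simp_thms)
next
  case False
  have rest: "V - (V - {0}) = {0}" by auto
  have "hamming_cost T T = 0"
    by (simp only: hamming_cost_pair[OF T_distinct T_distinct]) simp
  moreover have "\<beta>s \<noteq> \<infinity>" using False u_eq_1_iff by blast
  ultimately show ?thesis
    by (simp only: voronoi_pair[OF zero_less_one] cell_of_hub rest if_not_P[OF False] if_False simp_thms)
qed

text \<open>Seeds with \<open>p = 1\<close>, seeds inside one triangle and seeds with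
  \<open>7 \<le> q\<close> all end with the hub and the rival \<open>q\<close>, at cost 2.\<close>

lemma outcome_eq:
  assumes "p < q" "q \<in> V" "1 \<le> \<beta>"
  shows "outcome \<beta> {p, q} =
    (if p = 0 \<and> q = 1 then if \<beta>s = \<infinity> then 2 else 0
     else if p = 0 \<and> q \<in> {2, 3, 4} then if \<beta> < \<beta>s then 2 else 1
     else if p \<in> {2, 3, 4} \<and> q \<in> {5, 6} then if \<beta> \<le> \<beta>s then if \<beta>s = \<infinity> then 2 else 0 else 1
     else 2)"
proof -
  consider "p = 0" "q = 1" | "p = 0" "q \<in> {2, 3, 4}" | "p \<in> {2, 3, 4}" "q \<in> {5, 6}"
    | "p = 1" | "{p, q} \<subseteq> {0, 5, 6}" | "{p, q} \<subseteq> {2, 3, 4}" | "7 \<le> q"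
  proof -
    have "p \<in> V" using assms by simp
    then have "p = 0 \<and> q = 1 \<or> p = 0 \<and> q \<in> {2, 3, 4} \<or> p \<in> {2, 3, 4} \<and> q \<in> {5, 6} \<or> p = 1
        \<or> {p, q} \<subseteq> {0, 5, 6} \<or> {p, q} \<subseteq> {2, 3, 4} \<or> 7 \<le> q"
      using assms(1,2) unfolding V_eq by (elim insertE emptyE) simp_all
    then show ?thesis using that by blast
  qed
  then show ?thesis
  proof cases
    case 1
    then show ?thesis
      by (simp only: outcome_def lloyd_hub_0[OF assms(3)] hamming_cost_hub_0) simp
  next
    case 2
    then show ?thesis
      using hamming_cost_hub_alone hamming_cost_hub_rival[of 2]
        lloyd_other_triangle(1)[OF assms(1,3)] by (auto simp: outcome_def)
  next
    case 3
    then have "lloyd V dst \<beta> {p, q} = (if \<beta> \<le> \<beta>s then {0, 1} else {1})"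
      by (intro lloyd_other_triangle(2)[OF assms(1,3)]) auto
    then show ?thesis
      using 3 hamming_cost_hub_alone hamming_cost_hub_0 by (auto simp: outcome_def)
  next
    case 4
    then have "1 < q" using assms by simp
    then show ?thesis
      using 4 lloyd_hub_rival[OF assms(2) _ assms(3)] hamming_cost_hub_rival[OF assms(2)]
      by (simp add: outcome_def)
  next
    case 5
    then have "1 < q" using assms by auto
    then show ?thesis
      using 5 assms lloyd_separated[OF assms(1,2) _ cell_of_same_triangle[OF assms(1)]]
        hamming_cost_hub_rival[OF assms(2)]
      by (auto simp: outcome_def)
  next
    case 6
    then have "1 < q" using assms by auto
    then show ?thesis
      using 6 assms lloyd_separated[OF assms(1,2) _ cell_of_same_triangle[OF assms(1)]]
        hamming_cost_hub_rival[OF assms(2)]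
      by (auto simp: outcome_def)
  next
    case 7
    then show ?thesis
      using assms lloyd_separated[OF assms(1,2) _ cell_of_far[OF assms(1)]]
        hamming_cost_hub_rival[OF assms(2)]
      by (auto simp: outcome_def)
  qed
qed


subsection \<open>The expected cost\<close>

text \<open>The normalizing constant seen from a triangle point: the hub, two vertices of the same
  triangle, three of the other, three far points.\<close>

definition total_weight :: "real \<Rightarrow> real" where
  "total_weight a = 1 + 2 * u powr a + 3 * \<delta> powr a + 3 * \<phi> powr a"

text \<open>
  The probabilities with which a triangle point, as first center, is followed by the hub and by a
  given point of the other triangle.
\<close>

definition hub_prob :: "ereal \<Rightarrow> real" where
  "hub_prob \<alpha> = (if \<alpha> = \<infinity> then 0 else 1 / total_weight (real_of_ereal \<alpha>))"

definition cross_prob :: "ereal \<Rightarrow> real" where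
  "cross_prob \<alpha> =
    (if \<alpha> = \<infinity> then if \<delta> = \<phi> then 1 / 6 else 0
     else \<delta> powr real_of_ereal \<alpha> / total_weight (real_of_ereal \<alpha>))"

lemma next_center_infty_triangle:
  assumes "k \<in> {0, 2, 3, 4, 5, 6}"
  shows "next_center V dst \<infinity> {k} = pmf_of_set {w \<in> V. dst w k = \<phi>}"
proof -
  have le: "dst w k \<le> \<phi>" for w
    using assms u_ge u_less \<delta>_le by (auto simp: dst_def)
  have "dst 7 k = \<phi>" "7 \<in> V" using assms by (auto simp: dst_def)
  then have "is_arg_max (\<lambda>v. dst v k) (\<lambda>v. v \<in> V) w \<longleftrightarrow> w \<in> V \<and> dst w k = \<phi>" for w
    using le unfolding is_arg_max_linorder by (metis order_antisym)
  then have "{w. is_arg_max (\<lambda>v. dst v k) (\<lambda>v. v \<in> V) w} = {w \<in> V. dst w k = \<phi>}" by blast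
  then show ?thesis by (simp add: next_center_def dmin_singleton)
qed

lemma next_center_infty_hub: "next_center V dst \<infinity> {1} = pmf_of_set (V - {1})"
proof -
  have "is_arg_max (\<lambda>v. dst v 1) (\<lambda>v. v \<in> V) w \<longleftrightarrow> w \<in> V - {1}" for w
  proof (cases "w = 1")
    case True
    then show ?thesis by (auto simp: is_arg_max_linorder intro!: exI[of _ 0])
  next
    case False
    have "dst v 1 \<le> 1" for v by (cases "v = 1") auto
    then show ?thesis using False by (auto simp: is_arg_max_linorder)
  qed
  then have "{w. is_arg_max (\<lambda>v. dst v 1) (\<lambda>v. v \<in> V) w} = V - {1}" by blast
  then show ?thesis by (simp add: next_center_def dmin_singleton)
qed

lemma pmf_next_center_finite:
  assumes "\<alpha> \<noteq> \<infinity>" "v \<in> V"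
  shows "pmf (next_center V dst \<alpha> {v}) w =
    (if w \<in> V then dst w v powr real_of_ereal \<alpha> / (\<Sum>x\<in>V. dst x v powr real_of_ereal \<alpha>) else 0)"
  using assms Metric_space_dst
  by (subst pmf_next_center) (auto simp: dmin_singleton psubset_eq V_eq)

text \<open>A chosen point is never drawn again: its weight is 0 for finite \<open>\<alpha>\<close>,
  also for \<open>\<alpha> = 0\<close>, and for \<open>\<alpha> = \<infinity>\<close> another point
  is farther away.\<close>

lemma set_pmf_next_center:
  assumes "v \<in> V"
  shows "set_pmf (next_center V dst \<alpha> {v}) \<subseteq> V - {v}"
proof (cases "\<alpha> = \<infinity>")
  case True
  let ?M = "{w. is_arg_max (\<lambda>w. dst w v) (\<lambda>w. w \<in> V) w}"
  have "Max ((\<lambda>w. dst w v) ` V) \<in> (\<lambda>w. dst w v) ` V"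
    by (intro Max_in) (auto simp: V_eq)
  then obtain m where m: "m \<in> V" "dst m v = Max ((\<lambda>w. dst w v) ` V)" by auto
  then have "m \<in> ?M" by (auto simp: is_arg_max_linorder)
  moreover have "finite ?M" by (rule finite_subset[of _ V]) (auto simp: is_arg_max_def)
  ultimately have "set_pmf (pmf_of_set ?M) = ?M" by (intro set_pmf_of_set) auto
  moreover have "v \<notin> ?M"
  proof -
    define w :: nat where "w = (if v = 0 then 1 else 0)"
    have "w \<noteq> v" "w \<in> V" by (auto simp: w_def)
    then have "0 < dst w v" using dst_bounds[of w v] by simp
    then show ?thesis using \<open>w \<in> V\<close> by (auto simp: is_arg_max_def intro!: exI[of _ w])
  qed
  moreover have "?M \<subseteq> V" by (auto simp: is_arg_max_def)
  moreover have "next_center V dst \<alpha> {v} = pmf_of_set ?M"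
    using True by (simp add: next_center_def dmin_singleton)
  ultimately show ?thesis by auto
next
  case False
  then show ?thesis
    using pmf_next_center_finite[OF False assms] by (auto simp: set_pmf_iff split: if_splits)
qed

lemma sum_weights:
  assumes "k \<in> {0, 2, 3, 4, 5, 6}"
  shows "(\<Sum>x\<in>V. dst x k powr a) = total_weight a"
  using assms u_ge by (auto simp: V_eq total_weight_def dst_def)

lemma prob_hub:
  assumes "k \<in> {0, 2, 3, 4, 5, 6}"
  shows "pmf (next_center V dst \<alpha> {k}) 1 = hub_prob \<alpha>"
proof (cases "\<alpha> = \<infinity>")
  case True
  have "dst 1 k \<noteq> \<phi>" "7 \<in> {w \<in> V. dst w k = \<phi>}"
    using assms u_ge u_less \<delta>_le by (auto simp: dst_def)
  moreover from this(2) have "{w \<in> V. dst w k = \<phi>} \<noteq> {}" by blast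
  ultimately show ?thesis
    unfolding True next_center_infty_triangle[OF assms] hub_prob_def
    by (subst pmf_of_set) auto
next
  case False
  then show ?thesis
    using assms by (subst pmf_next_center_finite) (auto simp: sum_weights[OF assms] hub_prob_def)
qed

lemma prob_cross:
  assumes "k \<in> {0, 5, 6} \<and> l \<in> {2, 3, 4} \<or> k \<in> {2, 3, 4} \<and> l \<in> {0, 5, 6}"
  shows "pmf (next_center V dst \<alpha> {k}) l = cross_prob \<alpha>"
proof -
  have "k \<in> {0, 2, 3, 4, 5, 6} \<and> k \<in> V \<and> l \<in> V \<and> dst l k = \<delta> \<and> dst 7 k = \<phi>"
    using assms by (elim disjE conjE insertE emptyE) (simp_all add: dst_def)
  then have k: "k \<in> {0, 2, 3, 4, 5, 6}" "k \<in> V" and lk: "dst l k = \<delta>" "l \<in> V" and far: "dst 7 k = \<phi>"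
    by blast+
  show ?thesis
  proof (cases "\<alpha> = \<infinity>")
    case True
    have "7 \<in> {w \<in> V. dst w k = \<phi>}" using far by simp
    then have ne: "{w \<in> V. dst w k = \<phi>} \<noteq> {}" by blast
    \<comment> \<open>The other triangle and the far points; all of them are farthest if
      \<open>\<delta> = \<phi>\<close>.\<close>
    have "card {w \<in> V. dst w k = \<delta> \<or> dst w k = \<phi>} = 6"
    proof -
      have "dst w k = \<delta> \<or> dst w k = \<phi> \<longleftrightarrow>
          w \<noteq> 1 \<and> w \<notin> (if k \<in> {2, 3, 4} then {2, 3, 4} else {0, 5, 6})" if "w \<in> V" for w
        using that k(1) u_ge u_less \<delta>_le unfolding V_eq
        by (elim insertE emptyE) (auto simp: dst_def)
      then have "{w \<in> V. dst w k = \<delta> \<or> dst w k = \<phi>} =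
          V - insert 1 (if k \<in> {2, 3, 4} then {2, 3, 4} else {0, 5, 6})" by blast
      moreover have "card (V - {1, 2, 3, 4}) = 6" "card (V - {1, 0, 5, 6}) = 6"
        by (subst card_Diff_subset; simp)+
      ultimately show ?thesis by presburger
    qed
    then have "card {w \<in> V. dst w k = \<phi>} = 6" if "\<delta> = \<phi>"
      unfolding that by (simp only: simp_thms)
    then show ?thesis
      unfolding True next_center_infty_triangle[OF k(1)] cross_prob_def
      using ne lk by (subst pmf_of_set) auto
  next
    case False
    then show ?thesis
      using k lk by (subst pmf_next_center_finite) (simp_all add: sum_weights cross_prob_def)
  qed
qed

text \<open>The nine other points are equidistant from the hub, so every \<open>\<alpha>\<close>
  samples them uniformly.\<close>

lemma prob_from_hub:
  assumes "w \<in> V" "w \<noteq> 1"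
  shows "pmf (next_center V dst \<alpha> {1}) w = 1 / 9"
proof (cases "\<alpha> = \<infinity>")
  case True
  have "card (V - {1}) = 9" by simp
  then show ?thesis
    using assms unfolding True next_center_infty_hub by (subst pmf_of_set) auto
next
  case False
  have "(\<Sum>x\<in>V. dst x 1 powr a) = 9" for a by (simp add: V_eq)
  then show ?thesis
    using assms False by (subst pmf_next_center_finite) auto
qed

section \<open>The expected cost as a deficit from 2, the largest outcome\<close>

definition gain :: "ereal \<Rightarrow> nat set \<Rightarrow> real" where
  "gain \<beta> C = 2 - real (outcome \<beta> C)"

lemma sum_prob_gain:
  assumes "1 \<le> \<beta>" "v \<in> V"
  shows "(\<Sum>w\<in>V. pmf (next_center V dst \<alpha> {v}) w * real (outcome \<beta> {v, w})) =
    2 - (\<Sum>w\<in>V. pmf (next_center V dst \<alpha> {v}) w * gain \<beta> {v, w})"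
proof -
  have "(\<Sum>w\<in>V. pmf (next_center V dst \<alpha> {v}) w) = 1"
    using set_pmf_next_center[OF assms(2)] by (intro sum_pmf_eq_1) auto
  then have "2 = (\<Sum>w\<in>V. pmf (next_center V dst \<alpha> {v}) w * 2)"
    by (simp flip: sum_distrib_right)
  then show ?thesis by (simp add: gain_def right_diff_distrib sum_subtractf)
qed

lemma gain_eq:
  assumes "p < q" "q \<in> V" "1 \<le> \<beta>"
  shows "gain \<beta> {p, q} =
    (if p = 0 \<and> q = 1 then if \<beta>s = \<infinity> then 0 else 2
     else if p = 0 \<and> q \<in> {2, 3, 4} then if \<beta> < \<beta>s then 0 else 1
     else if p \<in> {2, 3, 4} \<and> q \<in> {5, 6} then if \<beta> \<le> \<beta>s then if \<beta>s = \<infinity> then 0 else 2 else 1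
     else 0)"
  unfolding gain_def outcome_eq[OF assms] by auto

definition hub_gain :: real where
  "hub_gain = (if \<beta>s = \<infinity> then 0 else 2)"

text \<open>Ordered seeds are counted: 6 join 0 to \<open>{2, 3, 4}\<close>, and 12 join
  \<open>{2, 3, 4}\<close> to \<open>{5, 6}\<close>.\<close>

definition cross_gain :: "ereal \<Rightarrow> real" where
  "cross_gain \<beta> = 6 * (if \<beta> < \<beta>s then 0 else 1) + 12 * (if \<beta> \<le> \<beta>s then hub_gain else 1)"

text \<open>Only the seed \<open>{0, 1}\<close> and the seeds meeting both triangles can gain. The
  hub follows 0 with probability \<open>hub_prob \<alpha>\<close>, and 0 follows the hub with
  probability 1/9; the factor 1/10 is the uniform first center.\<close>

lemma clus_eq:
  assumes "1 \<le> \<beta>"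
  shows "clus V dst 2 T \<alpha> \<beta> =
    2 - (hub_gain / 9 + hub_gain * hub_prob \<alpha> + cross_gain \<beta> * cross_prob \<alpha>) / 10"
proof -
  define P where "P v w = pmf (next_center V dst \<alpha> {v}) w" for v w
  have self: "P v v = 0" if "v \<in> V" for v
  proof -
    have "v \<notin> set_pmf (next_center V dst \<alpha> {v})" using set_pmf_next_center[OF that] by blast
    then show ?thesis by (simp add: P_def set_pmf_iff)
  qed
  define x where "x = (if \<beta> < \<beta>s then 0 else 1 :: real)"
  define y where "y = (if \<beta> \<le> \<beta>s then hub_gain else 1 :: real)"
  \<comment> \<open>\<open>G\<close> charges each unordered pair to one of its orders, so that
    symmetrizing the double sum leaves ten pairs to evaluate.\<close>
  define G where "G v w =
    (if v = 0 \<and> w = 1 then hub_gain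
     else if v = 0 \<and> w \<in> {2, 3, 4} then x
     else if v \<in> {2, 3, 4} \<and> w \<in> {5, 6} then y
     else 0)" for v w :: nat
  have G: "gain \<beta> {v, w} = G v w + G w v" if "v \<in> V" "w \<in> V" "v \<noteq> w" for v w
  proof (cases "v < w")
    case True
    have "G w v = 0" using True by (auto simp: G_def)
    then show ?thesis
      using that gain_eq[OF True _ assms] by (simp add: G_def x_def y_def hub_gain_def)
  next
    case False
    with that have wv: "w < v" by simp
    have "G v w = 0" using wv by (auto simp: G_def)
    then show ?thesis
      using that gain_eq[OF wv _ assms] by (simp add: G_def x_def y_def hub_gain_def insert_commute)
  qed
  have "(\<Sum>v\<in>V. \<Sum>w\<in>V. P v w * real (outcome \<beta> {v, w})) =
      20 - (\<Sum>v\<in>V. \<Sum>w\<in>V. P v w * gain \<beta> {v, w})"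
    using sum_prob_gain[OF assms] by (simp add: P_def sum_subtractf)
  also have "(\<Sum>v\<in>V. \<Sum>w\<in>V. P v w * gain \<beta> {v, w}) = (\<Sum>v\<in>V. \<Sum>w\<in>V. P v w * (G v w + G w v))"
  proof (intro sum.cong refl)
    fix v w assume "v \<in> V" "w \<in> V"
    then show "P v w * gain \<beta> {v, w} = P v w * (G v w + G w v)"
      using G self by (cases "v = w") auto
  qed
  also have "\<dots> = (\<Sum>v\<in>V. \<Sum>w\<in>V. (P v w + P w v) * G v w)"
    by (simp add: distrib_left distrib_right sum.distrib) (rule sum.swap)
  also have "\<dots> = (P 0 1 + P 1 0) * hub_gain
      + ((P 0 2 + P 2 0) + (P 0 3 + P 3 0) + (P 0 4 + P 4 0)) * x
      + ((P 2 5 + P 5 2) + (P 2 6 + P 6 2) + (P 3 5 + P 5 3) + (P 3 6 + P 6 3)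
        + (P 4 5 + P 5 4) + (P 4 6 + P 6 4)) * y"
    by (simp add: V_eq G_def algebra_simps)
  also have "\<dots> = (hub_prob \<alpha> + 1 / 9) * hub_gain + 6 * cross_prob \<alpha> * x + 12 * cross_prob \<alpha> * y"
    using prob_from_hub[of 0 \<alpha>] prob_hub[of 0 \<alpha>] prob_cross[of _ _ \<alpha>] by (simp add: P_def)
  finally have "(\<Sum>v\<in>V. \<Sum>w\<in>V. P v w * real (outcome \<beta> {v, w})) =
      20 - (hub_gain / 9 + hub_gain * hub_prob \<alpha> + cross_gain \<beta> * cross_prob \<alpha>)"
    by (simp add: cross_gain_def x_def y_def algebra_simps)
  moreover have "clus V dst 2 T \<alpha> \<beta> = (\<Sum>v\<in>V. \<Sum>w\<in>V. P v w * real (outcome \<beta> {v, w})) / 10"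
  proof (subst clus_two_centers)
    show "V \<noteq> {}" by (simp add: lessThan_empty_iff)
    show "set_pmf (next_center V dst \<alpha> {v}) \<subseteq> V" if "v \<in> V" for v
      using set_pmf_next_center[OF that] by blast
  qed (simp_all add: P_def outcome_def)
  ultimately show ?thesis by (simp add: diff_divide_distrib)
qed

text \<open>Below \<open>\<beta>s\<close> the 6 seeds with 0 lose their gain; above it, where
  \<open>\<beta>s\<close> is finite, the gain of the 12 others drops from 2 to 1.\<close>

lemma cross_gain_less:
  assumes "1 \<le> \<beta>" "\<beta> \<noteq> \<beta>s"
  shows "cross_gain \<beta> < cross_gain \<beta>s"
proof (cases "\<beta> < \<beta>s")
  case False
  with assms have less: "\<beta>s < \<beta>" by simp
  then have "hub_gain = 2" by (auto simp: hub_gain_def)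
  moreover have "\<not> \<beta> \<le> \<beta>s" using less by simp
  ultimately show ?thesis using False by (simp add: cross_gain_def)
qed (simp add: cross_gain_def less_imp_le)

lemma gain_bounds: "0 \<le> hub_gain" "15 * hub_gain \<le> cross_gain \<beta>s" "0 < cross_gain \<beta>s"
  by (auto simp: cross_gain_def hub_gain_def)

lemma total_weight_pos: "0 < total_weight a"
  by (simp add: total_weight_def add_pos_nonneg)

lemma cross_prob_nonneg: "0 \<le> cross_prob \<alpha>"
  using total_weight_pos[of "real_of_ereal \<alpha>"] by (simp add: cross_prob_def)

text \<open>\<open>\<beta>\<close> enters only through \<open>cross_gain\<close>, which is largest
  only at \<open>\<beta>s\<close>, so it is enough to maximize over \<open>\<alpha>\<close> with
  \<open>\<beta>s\<close> fixed. Positivity of \<open>cross_prob \<alpha>s\<close> gives strictness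
  when only \<open>\<beta>\<close> differs.\<close>

lemma clus_less:
  assumes peak: "\<And>\<alpha>. 0 \<le> \<alpha> \<Longrightarrow> \<alpha> \<noteq> \<alpha>s \<Longrightarrow>
      hub_gain * hub_prob \<alpha> + cross_gain \<beta>s * cross_prob \<alpha> <
      hub_gain * hub_prob \<alpha>s + cross_gain \<beta>s * cross_prob \<alpha>s"
    and pos: "0 < cross_prob \<alpha>s"
    and \<alpha>\<beta>: "0 \<le> \<alpha>" "1 \<le> \<beta>" "(\<alpha>, \<beta>) \<noteq> (\<alpha>s, \<beta>s)"
  shows "clus V dst 2 T \<alpha>s \<beta>s < clus V dst 2 T \<alpha> \<beta>"
proof -
  have "hub_gain * hub_prob \<alpha> + cross_gain \<beta> * cross_prob \<alpha> <
      hub_gain * hub_prob \<alpha>s + cross_gain \<beta>s * cross_prob \<alpha>s"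
  proof (cases "\<alpha> = \<alpha>s")
    case True
    then show ?thesis using \<alpha>\<beta> cross_gain_less pos by simp
  next
    case False
    have "cross_gain \<beta> * cross_prob \<alpha> \<le> cross_gain \<beta>s * cross_prob \<alpha>"
      using cross_gain_less[OF \<alpha>\<beta>(2)] cross_prob_nonneg
      by (intro mult_right_mono) (cases "\<beta> = \<beta>s", auto)
    then show ?thesis using peak[OF \<alpha>\<beta>(1) False] by linarith
  qed
  then show ?thesis using clus_eq[OF \<alpha>\<beta>(2)] clus_eq[OF \<beta>s_ge] by simp
qed

end


subsection \<open>Choosing the largest distance\<close>

text \<open>
  Fermat's condition at \<open>\<alpha>\<close> determines \<open>\<phi>\<close> through the intermediate value theorem, with unknown
  \<open>x = ln (\<phi> / \<delta>)\<close>. It suffices for a strict global maximum \<open>s\<close>, because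
  \<open>s\<close> times the denominator minus the numerator, divided by \<open>\<delta> powr a\<close>, is a constant plus a
  combination of exponentials in \<open>a\<close> with nonnegative coefficients, hence lies above its tangent
  at \<open>\<alpha>\<close>.
\<close>

lemma obtain_peak:
  fixes \<alpha> u \<delta> c0 c :: real
  assumes \<alpha>: "0 \<le> \<alpha>" and u: "1 \<le> u" "u \<le> 3 / 2" and \<delta>: "\<delta> = 21 / 20 * u"
    and c0: "0 \<le> c0" "15 * c0 \<le> c" and c: "0 < c"
  obtains \<phi> where "\<delta> < \<phi>" "\<phi> \<le> 2"
    "\<And>a. a \<noteq> \<alpha> \<Longrightarrow>
      (c0 + c * \<delta> powr a) / (1 + 2 * u powr a + 3 * \<delta> powr a + 3 * \<phi> powr a) <
      (c0 + c * \<delta> powr \<alpha>) / (1 + 2 * u powr \<alpha> + 3 * \<delta> powr \<alpha> + 3 * \<phi> powr \<alpha>)"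
proof -
  define D where "D = ln \<delta>"
  define t where "t = ln (21 / 20 :: real)"
  \<comment> \<open>At \<open>\<alpha>\<close>, after division by
    \<open>\<delta> powr \<alpha>\<close>, the numerator is \<open>n\<close> and the denominator is
    \<open>q + 2 * w + 3 + 3 * Y x\<close>.\<close>
  define q where "q = exp (- (\<alpha> * D))"
  define w where "w = exp (- (\<alpha> * t))"
  define n where "n = c0 * q + c"
  define Y where "Y x = exp (\<alpha> * x)" for x
  \<comment> \<open>Fermat's condition multiplied by the denominator, which eliminates
    \<open>s\<close>. The endpoint \<open>X\<close> corresponds to
    \<open>\<phi> = 2\<close>.\<close>
  define H where "H x = 3 * n * x * Y x - (c - c0 * (2 * w + 3 + 3 * Y x)) * q * D - 2 * n * w * t" for x
  define X where "X = ln (2 / \<delta>)"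
  have \<delta>_pos: "1 < \<delta>" "\<delta> \<le> 63 / 40" using u \<delta> by auto
  have pos: "0 < D" "0 < t" using \<delta>_pos by (auto simp: D_def t_def)
  have qw: "0 < q" "q \<le> 1" "0 < w" "w \<le> 1"
    using \<alpha> pos by (auto simp: q_def w_def)
  have n: "c \<le> n" "0 < n" using c0 c qw by (auto simp: n_def add_nonneg_pos)
  have X: "0 \<le> X" using \<delta>_pos by (simp add: X_def)
  \<comment> \<open>This makes \<open>H\<close> nonnegative at \<open>X\<close>; the largest
    possible \<open>\<delta>\<close>, \<open>21/20 * 3/2 = 63/40\<close>, is small enough for
    it.\<close>
  have XD: "D + 2 * t \<le> 3 * X"
  proof -
    have "\<delta> ^ 4 * (21 / 20) ^ 2 \<le> (63 / 40) ^ 4 * (21 / 20 :: real) ^ 2"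
      using \<delta>_pos by (intro mult_right_mono power_mono) auto
    also have "\<dots> \<le> 2 ^ 3" by (simp add: field_simps)
    finally have "ln (\<delta> ^ 4 * (21 / 20) ^ 2) \<le> ln (2 ^ 3 :: real)"
      using \<delta>_pos by (intro ln_mono) auto
    also have "\<dots> = 3 * ln 2" by (subst ln_realpow) simp_all
    finally have "4 * D + 2 * t \<le> 3 * ln 2"
      using \<delta>_pos by (simp add: ln_mult ln_realpow D_def t_def)
    moreover have "X = ln 2 - D" using \<delta>_pos by (simp add: X_def D_def ln_div)
    ultimately show ?thesis by simp
  qed
  have cw: "c0 * (2 * w) \<le> c0 * 2" using c0 qw by (intro mult_left_mono) auto
  have "H 0 \<le> 0"
  proof -
    have "c0 * (2 * w + 3 + 3) \<le> c" using cw c0 by (simp add: algebra_simps)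
    then have "0 \<le> (c - c0 * (2 * w + 3 + 3)) * q * D"
      using pos qw by (intro mult_nonneg_nonneg) auto
    moreover have "0 \<le> 2 * n * w * t" using pos qw n by simp
    moreover have "H 0 = - ((c - c0 * (2 * w + 3 + 3)) * q * D) - 2 * n * w * t"
      by (simp add: H_def Y_def)
    ultimately show ?thesis by linarith
  qed
  moreover have "0 \<le> H X"
  proof -
    have Y1: "1 \<le> Y X" using \<alpha> X by (simp add: Y_def)
    have "(c - c0 * (2 * w + 3 + 3 * Y X)) * q * D \<le> n * 1 * D"
    proof (intro mult_right_mono)
      have "c - c0 * (2 * w + 3 + 3 * Y X) \<le> n"
        using n c0 qw Y1 by (smt (verit) mult_nonneg_nonneg)
      then have "(c - c0 * (2 * w + 3 + 3 * Y X)) * q \<le> n * q"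
        using qw by (intro mult_right_mono) auto
      also have "\<dots> \<le> n * 1" using n qw by (intro mult_left_mono) auto
      finally show "(c - c0 * (2 * w + 3 + 3 * Y X)) * q \<le> n * 1" .
    qed (use pos in auto)
    moreover have "2 * n * w * t \<le> 2 * n * 1 * t"
      using n pos qw by (intro mult_right_mono mult_left_mono) auto
    moreover have "n * (D + 2 * t) \<le> n * (3 * X)" using n XD by (intro mult_left_mono) auto
    moreover have "3 * n * X * 1 \<le> 3 * n * X * Y X"
      using n X Y1 by (intro mult_left_mono) auto
    ultimately show ?thesis by (simp add: H_def algebra_simps)
  qed
  moreover have "continuous_on {0..X} H"
    unfolding H_def Y_def by (intro continuous_intros)
  ultimately obtain x where x: "0 \<le> x" "x \<le> X" and Hx: "H x = 0"
    using IVT'[of H 0 0 X] X by blast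
  define y where "y = Y x"
  have y1: "1 \<le> y" using \<alpha> x by (simp add: y_def Y_def)
  have root: "3 * n * x * y = (c - c0 * (2 * w + 3 + 3 * y)) * q * D + 2 * n * w * t"
    using Hx by (simp add: H_def y_def)
  \<comment> \<open>This is \<open>s - c0\<close> times the denominator. If it were negative,
    \<open>15 * c0 \<le> c\<close> would force \<open>3 * y > 10\<close>, hence
    \<open>\<alpha> * x \<ge> 1\<close> as \<open>exp 1 \<le> 3\<close>. But \<open>root\<close>
    then bounds \<open>3 * \<alpha> * x * y\<close> by \<open>2 * \<alpha> * t * w\<close>, which is
    at most 2 because \<open>z * exp (- z) \<le> 1\<close>.\<close>
  have coeff: "0 \<le> c - c0 * (2 * w + 3 + 3 * y)"
  proof (rule ccontr)
    assume "\<not> ?thesis"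
    then have neg: "c - c0 * (2 * w + 3 + 3 * y) < 0" by simp
    then have "15 * c0 < c0 * (5 + 3 * y)" using c0 cw by (simp add: algebra_simps)
    then have "0 < c0 * (3 * y - 10)" by (simp add: algebra_simps)
    then have y: "10 < 3 * y" using c0 by (simp add: zero_less_mult_iff)
    have "(c - c0 * (2 * w + 3 + 3 * y)) * q * D \<le> 0"
      using neg qw pos by (intro mult_nonpos_nonneg) auto
    then have "n * (3 * x * y) \<le> n * (2 * w * t)" using root by (simp add: algebra_simps)
    then have "3 * x * y \<le> 2 * w * t" using n by simp
    then have "\<alpha> * (3 * x * y) \<le> \<alpha> * (2 * w * t)" using \<alpha> by (intro mult_left_mono)
    moreover have "\<alpha> * t * w \<le> 1"
    proof -
      have "\<alpha> * t \<le> exp (\<alpha> * t)" using exp_ge_add_one_self[of "\<alpha> * t"] by linarith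
      then have "\<alpha> * t * w \<le> exp (\<alpha> * t) * w" using qw by (intro mult_right_mono) auto
      then show ?thesis by (simp add: w_def flip: exp_add)
    qed
    ultimately have "3 * (\<alpha> * x) * y \<le> 2" by (simp add: algebra_simps)
    moreover have "1 \<le> \<alpha> * x"
    proof (rule ccontr)
      assume "\<not> 1 \<le> \<alpha> * x"
      then have "y \<le> exp 1" by (simp add: y_def Y_def)
      then show False using y exp_le by linarith
    qed
    then have "1 * y \<le> (\<alpha> * x) * y" using y1 by (intro mult_right_mono) auto
    ultimately show False using y by simp
  qed
  \<comment> \<open>The summand of \<open>root\<close> with \<open>t\<close> is positive, which
    excludes \<open>x = 0\<close> and yields \<open>\<phi> > \<delta>\<close>.\<close>
  have x_pos: "0 < x"
  proof (rule ccontr)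
    assume "\<not> 0 < x"
    then have "x = 0" using x by simp
    then have "(c - c0 * (2 * w + 3 + 3 * y)) * q * D + 2 * n * w * t = 0" using root by simp
    moreover have "0 \<le> (c - c0 * (2 * w + 3 + 3 * y)) * q * D"
      using coeff qw pos by simp
    moreover have "0 < 2 * n * w * t" using n qw pos by simp
    ultimately show False by linarith
  qed
  define \<phi> where "\<phi> = \<delta> * exp x"
  define E where "E = q + 2 * w + 3 + 3 * y"
  define s where "s = n / E"
  have E: "0 < E" using qw y1 by (simp add: E_def)
  have s: "0 < s" "s * E = n" using n E by (auto simp: s_def)
  have sc: "(s - c0) * E = c - c0 * (2 * w + 3 + 3 * y)"
    using s by (simp add: left_diff_distrib) (simp add: n_def E_def algebra_simps)
  then have s_ge: "c0 \<le> s" using coeff E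
    by (metis diff_ge_0_iff_ge not_le zero_le_mult_iff)
  have slope: "3 * s * x * y = (s - c0) * q * D + 2 * s * w * t"
  proof -
    have "E * (3 * s * x * y) = 3 * (s * E) * x * y" by simp
    also have "\<dots> = ((s - c0) * E) * q * D + 2 * (s * E) * w * t"
      unfolding s(2) sc by (rule root)
    also have "\<dots> = E * ((s - c0) * q * D + 2 * s * w * t)" by (simp add: algebra_simps)
    finally show ?thesis using E by simp
  qed
  have lnphi: "ln \<phi> = D + x" using \<delta>_pos by (simp add: \<phi>_def D_def ln_mult)
  have lnu: "ln u = D - t" unfolding D_def t_def \<delta> using u by (subst ln_mult) auto
  have "0 < \<phi>" using \<delta>_pos by (simp add: \<phi>_def)
  then have pw: "\<delta> powr a = exp (a * D)" "u powr a = exp (a * D) * exp (- (a * t))"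
    "\<phi> powr a = exp (a * D) * exp (a * x)" for a
    using \<delta>_pos u
    by (simp_all add: powr_def lnphi lnu D_def[symmetric] algebra_simps flip: exp_add)
  define F where "F a = exp (- (a * D)) + 2 * exp (- (a * t)) + 3 + 3 * exp (a * x)" for a
  have den: "1 + 2 * u powr a + 3 * \<delta> powr a + 3 * \<phi> powr a = exp (a * D) * F a" for a
    by (simp add: pw F_def algebra_simps flip: exp_add)
  have num: "c0 + c * \<delta> powr a = exp (a * D) * (c0 * exp (- (a * D)) + c)" for a
    by (simp add: pw algebra_simps flip: exp_add)
  have F_pos: "0 < F a" for a by (simp add: F_def add_pos_pos)
  have ratio: "(c0 + c * \<delta> powr a) / (1 + 2 * u powr a + 3 * \<delta> powr a + 3 * \<phi> powr a) =
      (c0 * exp (- (a * D)) + c) / F a" for a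
    unfolding den num by simp
  have at: "(c0 * exp (- (\<alpha> * D)) + c) / F \<alpha> = s"
    by (simp add: s_def n_def E_def F_def q_def w_def y_def Y_def)
  have less: "(c0 * exp (- (a * D)) + c) / F a < s" if "a \<noteq> \<alpha>" for a
  proof -
    define b where "b = a - \<alpha>"
    have b: "b \<noteq> 0" using that by (simp add: b_def)
    have "exp (- (a * D)) = q * exp (- (b * D))" "exp (- (a * t)) = w * exp (- (b * t))"
      "exp (a * x) = y * exp (b * x)"
      by (simp_all add: q_def w_def y_def Y_def b_def algebra_simps flip: exp_add)
    note e = this
    have "1 + - (b * D) \<le> exp (- (b * D))" "1 + b * x \<le> exp (b * x)"
      by (rule exp_ge_add_one_self)+
    then have e1: "(s - c0) * q * (1 - b * D) \<le> (s - c0) * q * exp (- (b * D))"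
      and e3: "3 * s * y * (1 + b * x) \<le> 3 * s * y * exp (b * x)"
      using s s_ge qw y1 by (auto intro!: mult_left_mono)
    \<comment> \<open>Strictness is taken from this term, whose coefficient \<open>2 * s * w\<close>
      is positive.\<close>
    have "exp (- (b * t)) \<noteq> 1 + - (b * t)"
      using b pos ln_eq_minus_one[of "exp (- (b * t))"] by auto
    then have "1 + - (b * t) < exp (- (b * t))"
      using exp_ge_add_one_self[of "- (b * t)"] by linarith
    then have e2: "2 * s * w * (1 - b * t) < 2 * s * w * exp (- (b * t))"
      using s qw by (intro mult_strict_left_mono) auto
    \<comment> \<open>The tangent at \<open>\<alpha>\<close> is zero: the value vanishes by the
      choice of \<open>s\<close>, the derivative by \<open>slope\<close>.\<close>
    have "0 = s * E - n + b * (3 * s * x * y - (s - c0) * q * D - 2 * s * w * t)"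
      using s slope by simp
    also have "\<dots> = (s - c0) * q * (1 - b * D) + 2 * s * w * (1 - b * t)
        + 3 * s * y * (1 + b * x) + 3 * s - c"
      by (simp add: E_def n_def algebra_simps)
    also have "\<dots> < (s - c0) * q * exp (- (b * D)) + 2 * s * w * exp (- (b * t))
        + 3 * s * y * exp (b * x) + 3 * s - c"
      using e1 e2 e3 by linarith
    also have "\<dots> = s * F a - (c0 * exp (- (a * D)) + c)"
      unfolding F_def e by (simp add: algebra_simps)
    finally show ?thesis using F_pos[of a] by (simp add: pos_divide_less_eq)
  qed
  show ?thesis
  proof (rule that)
    show "\<delta> < \<phi>" using \<delta>_pos x_pos by (simp add: \<phi>_def)
    have "exp x \<le> exp X" using x by simp
    also have "\<dots> = 2 / \<delta>" using \<delta>_pos by (simp add: X_def)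
    finally show "\<phi> \<le> 2" using \<delta>_pos by (simp add: \<phi>_def field_simps)
  qed (unfold ratio at, rule less)
qed

section \<open>Choice of \<open>\<phi>\<close> and conclusion\<close>

theorem theorem2:
  fixes \<alpha>s \<beta>s :: ereal
  assumes "\<alpha>s \<in> {ereal 0.01..}" and "\<beta>s \<in> {1..}"
  shows "\<exists>(V :: nat set) d k T.
    clustering_instance V d k T \<and>
    optimal_clustering V d k \<beta>s T \<and>
    (\<forall>\<alpha>\<in>{0..}. \<forall>\<beta>\<in>{1..}. (\<alpha>, \<beta>) \<noteq> (\<alpha>s, \<beta>s) \<longrightarrow>
      clus V d k T \<alpha>s \<beta>s < clus V d k T \<alpha> \<beta>)"
proof -
  have \<alpha>s: "0 \<le> \<alpha>s" and \<beta>s: "1 \<le> \<beta>s"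
    using assms by (auto intro: order_trans[of 0 "ereal 0.01"])
  define u where "u = (if \<beta>s = \<infinity> then 1 else (3 / 2) powr (1 / real_of_ereal \<beta>s))"
  define \<delta> where "\<delta> = 21 / 20 * u"
  have "1 \<le> u \<and> u \<le> 3 / 2"
  proof (cases \<beta>s)
    case (real b)
    then have "1 \<le> b" using \<beta>s by simp
    then have "1 \<le> (3 / 2 :: real) powr (1 / b)" by (intro ge_one_powr_ge_zero) auto
    moreover have "(3 / 2 :: real) powr (1 / b) \<le> (3 / 2) powr 1"
      using \<open>1 \<le> b\<close> by (intro powr_mono) auto
    ultimately show ?thesis using real by (simp add: u_def)
  qed (use \<beta>s in \<open>auto simp: u_def\<close>)
  then have u: "1 \<le> u" "u \<le> 3 / 2" by auto
  have instance_exists: ?thesis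
    if "tuned_triangles u \<delta> \<phi> \<beta>s"
      and "\<And>\<alpha> \<beta>. 0 \<le> \<alpha> \<Longrightarrow> 1 \<le> \<beta> \<Longrightarrow> (\<alpha>, \<beta>) \<noteq> (\<alpha>s, \<beta>s) \<Longrightarrow>
        clus {..<10} (two_triangles.dst u \<delta> \<phi>) 2 {{0}, {..<10} - {0}} \<alpha>s \<beta>s <
        clus {..<10} (two_triangles.dst u \<delta> \<phi>) 2 {{0}, {..<10} - {0}} \<alpha> \<beta>" for \<phi>
  proof -
    interpret tuned_triangles u \<delta> \<phi> \<beta>s by fact
    show ?thesis
      using clustering_instance_T optimal_T[OF \<beta>s] that(2) by (metis atLeast_iff)
  qed
  show ?thesis
  proof (cases "\<alpha>s = \<infinity>")
    case True
    \<comment> \<open>With \<open>\<phi> = \<delta>\<close>, six points tie as farthest from a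
      triangle point, so \<open>cross_prob \<infinity> = 1 / 6\<close>; at finite exponents the hub
      and the same triangle take a share.\<close>
    interpret tuned_triangles u \<delta> \<delta> \<beta>s
      by unfold_locales (use u \<beta>s in \<open>auto simp: \<delta>_def u_def\<close>)
    show ?thesis
    proof (rule instance_exists[of \<delta>])
      fix \<alpha> \<beta> assume "0 \<le> \<alpha>" "1 \<le> \<beta>" "(\<alpha>, \<beta>) \<noteq> (\<alpha>s, \<beta>s)"
      then show "clus V dst 2 T \<alpha>s \<beta>s < clus V dst 2 T \<alpha> \<beta>"
      proof (rule clus_less[rotated 2])
        show "0 < cross_prob \<alpha>s" using True by (simp add: cross_prob_def)
        fix \<alpha> :: ereal assume "\<alpha> \<noteq> \<alpha>s"
        then have \<alpha>: "\<alpha> \<noteq> \<infinity>" using True by simp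
        define a where "a = real_of_ereal \<alpha>"
        have "6 * (hub_gain + cross_gain \<beta>s * \<delta> powr a) < cross_gain \<beta>s * total_weight a"
        proof -
          have "0 \<le> cross_gain \<beta>s * u powr a" using gain_bounds by simp
          \<comment> \<open>What the hub can gain at finite exponents is less than what its weight 1
            in \<open>total_weight\<close> costs.\<close>
          moreover have "6 * hub_gain < cross_gain \<beta>s" using gain_bounds by linarith
          moreover have "cross_gain \<beta>s * total_weight a =
              cross_gain \<beta>s + 2 * (cross_gain \<beta>s * u powr a) + 6 * (cross_gain \<beta>s * \<delta> powr a)"
            by (simp add: total_weight_def algebra_simps)
          moreover have "6 * (hub_gain + cross_gain \<beta>s * \<delta> powr a) =
              6 * hub_gain + 6 * (cross_gain \<beta>s * \<delta> powr a)" by simp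
          ultimately show ?thesis by linarith
        qed
        then have "(hub_gain + cross_gain \<beta>s * \<delta> powr a) / total_weight a < cross_gain \<beta>s / 6"
          using total_weight_pos[of a] by (simp add: field_simps)
        then show "hub_gain * hub_prob \<alpha> + cross_gain \<beta>s * cross_prob \<alpha> <
            hub_gain * hub_prob \<alpha>s + cross_gain \<beta>s * cross_prob \<alpha>s"
          using \<alpha> True by (simp add: hub_prob_def cross_prob_def a_def add_divide_distrib)
      qed
    qed unfold_locales
  next
    case False
    define as where "as = real_of_ereal \<alpha>s"
    have as: "\<alpha>s = ereal as" "0 \<le> as" using \<alpha>s False by (cases \<alpha>s; simp add: as_def)+
    \<comment> \<open>The values of \<open>hub_gain\<close> and \<open>cross_gain \<beta>s\<close>,
      written out because the locale can be interpreted only once \<open>\<phi>\<close> is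
      known.\<close>
    define c0 :: real where "c0 = (if \<beta>s = \<infinity> then 0 else 2)"
    define c :: real where "c = (if \<beta>s = \<infinity> then 6 else 30)"
    obtain \<phi> where \<phi>: "\<delta> < \<phi>" "\<phi> \<le> 2" and peak: "\<And>a. a \<noteq> as \<Longrightarrow>
        (c0 + c * \<delta> powr a) / (1 + 2 * u powr a + 3 * \<delta> powr a + 3 * \<phi> powr a) <
        (c0 + c * \<delta> powr as) / (1 + 2 * u powr as + 3 * \<delta> powr as + 3 * \<phi> powr as)"
      by (rule obtain_peak[OF as(2) u \<delta>_def, of c0 c]) (auto simp: c0_def c_def)
    interpret tuned_triangles u \<delta> \<phi> \<beta>s
      by unfold_locales (use u \<beta>s \<phi> in \<open>auto simp: \<delta>_def u_def\<close>)
    have c: "hub_gain = c0" "cross_gain \<beta>s = c"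
      by (auto simp: hub_gain_def cross_gain_def c0_def c_def)
    have value_eq: "hub_gain * hub_prob (ereal a) + cross_gain \<beta>s * cross_prob (ereal a) =
        (c0 + c * \<delta> powr a) / (1 + 2 * u powr a + 3 * \<delta> powr a + 3 * \<phi> powr a)" for a
      by (simp add: c hub_prob_def cross_prob_def total_weight_def add_divide_distrib)
    show ?thesis
    proof (rule instance_exists[of \<phi>])
      fix \<alpha> \<beta> assume "0 \<le> \<alpha>" "1 \<le> \<beta>" "(\<alpha>, \<beta>) \<noteq> (\<alpha>s, \<beta>s)"
      then show "clus V dst 2 T \<alpha>s \<beta>s < clus V dst 2 T \<alpha> \<beta>"
      proof (rule clus_less[rotated 2])
        show pos: "0 < cross_prob \<alpha>s"
          using u_ge u_less total_weight_pos[of as] as by (simp add: cross_prob_def)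
        fix \<alpha> :: ereal assume \<alpha>: "0 \<le> \<alpha>" "\<alpha> \<noteq> \<alpha>s"
        show "hub_gain * hub_prob \<alpha> + cross_gain \<beta>s * cross_prob \<alpha> <
            hub_gain * hub_prob \<alpha>s + cross_gain \<beta>s * cross_prob \<alpha>s"
        proof (cases \<alpha>)
          case (real a)
          then show ?thesis using \<alpha> as peak[of a] value_eq[of a] value_eq[of as] by auto
        next
          case PInf
          \<comment> \<open>Since \<open>\<delta> < \<phi>\<close>, only the far points are farthest
            from a triangle point, and both probabilities vanish.\<close>
          then have "hub_gain * hub_prob \<alpha> + cross_gain \<beta>s * cross_prob \<alpha> = 0"
            using \<phi> by (simp add: hub_prob_def cross_prob_def)
          moreover have "0 < cross_gain \<beta>s * cross_prob \<alpha>s"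
            using pos gain_bounds by simp
          moreover have "0 \<le> hub_gain * hub_prob \<alpha>s"
            using gain_bounds total_weight_pos[of as] as by (simp add: hub_prob_def)
          ultimately show ?thesis by linarith
        qed (use \<alpha> in simp)
      qed
    qed unfold_locales
  qed
qed

end
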